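(* Consider the problem of minimizing $\phi(x)=\mathbb{E}_\xi[F(x,\xi)]+\Psi(x)$ over $x\in\mathbb{R}^n$, and write $f(x)=\mathbb{E}_\xi[F(x,\xi)]$. Assume that: the set $X^\star$ of minimizers of $\phi$ is nonempty, with $\phi^\star$ the optimal value; for each $\xi\in\Xi$, $\|\nabla_xF(y,\xi)-\nabla_xF(z,\xi)\|_*\le L\|y-z\|$ for all $y,z\in\mathbb{R}^n$; there is a constant $\sigma\ge 0$ such that $\mathbb{E}_\xi[\|\nabla_xF(x,\xi)-\nabla f(x)\|_*^2]\le\sigma^2$ for all $x\in\mathbb{R}^n$; and $\Psi$ is simple (a term used informally) and lower semicontinuous, with closed effective domain. Suppose in addition that $\mathrm{dom}\,\Psi$ is compact and that $D_\omega(\cdot,\cdot)$ is bounded on $\mathrm{dom}\,\Psi$, and let $$R^2=\max_{x,y\in\mathrm{dom}\,\Psi}D_\omega(x,y).$$ Let $\{x(k)\}_{k\ge 0}$ be the iterates of the asynchronous mini-batch algorithm described in the context, with batch size $b$, delays bounded by $\tau_{\max}$, and step-sizes $$\gamma(k)^{-1}=L(\tau_{\max}+1)^2+\alpha(k),\qquad\alpha(k)=\frac{\sigma\sqrt c\,\sqrt{k+1}}{R\sqrt b},\qquad k\in\mathbb{N}_0,$$ where $c\in[1,b]$ is given by $c=1$ if $\|\cdot\|_*=\|\cdot\|_2$ and $c=2\max_{\|x\|\le1}\omega(x)$ otherwise. Then the Cesàro average $x_{\mathrm{ave}}(T)=\frac1T\sum_{k=1}^Tx(k)$ of the iterates satisfies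 $$\mathbb{E}\bigl[\phi(x_{\mathrm{ave}}(T))\bigr]-\phi^\star\le\frac{LR^2(\tau_{\max}+1)^2}{T}+\frac{2\sigma R\sqrt c}{\sqrt{bT}}$$ for all $T\in\mathbb{N}$.
   Context: Norms: $\mathbb{R}^n$ carries a norm $\|\cdot\|$ with dual norm $\|y\|_*=\sup_{\|x\|\le1}\langle x,y\rangle$; $\|\cdot\|_2$ is the Euclidean norm. $\mathbb{N}=\{1,2,\dots\}$ and $\mathbb{N}_0=\mathbb{N}\cup\{0\}$. Problem data: $\xi$ is a random vector with distribution $\mathcal{P}$ supported on $\Xi\subseteq\mathbb{R}^m$; $F(\cdot,\xi)$ is convex and differentiable for each $\xi\in\Xi$; $\Psi:\mathbb{R}^n\to\mathbb{R}\cup\{+\infty\}$ is a proper convex function, possibly nonsmooth, with effective domain $\mathrm{dom}\,\Psi=\{x:\Psi(x)<+\infty\}$. The function $f$ is convex and differentiable, with $\nabla f(x)=\mathbb{E}_\xi[\nabla_xF(x,\xi)]$. Bregman distance: $\omega:X\to\mathbb{R}$, with $\mathrm{dom}\,\Psi\subseteq X\subseteq\mathbb{R}^n$, is a distance generating function with modulus $1$ with respect to $\|\cdot\|$, i.e. $\omega$ is continuously differentiable and $\omega(y)\ge\omega(x)+\langle\nabla\omega(x),y-x\rangle+\frac12\|y-x\|^2$ for all $x,y\in X$. Its Bregman distance function is $D_\omega(x,y)=\omega(y)-\omega(x)-\langle\nabla\omega(x),y-x\rangle$. Algorithm: several processors share a memory holding the decision variable $x$ and update it without synchronization. Start from $x(0)\in\mathrm{dom}\,\Psi$,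 with batch size $b\in\mathbb{N}$ and positive step-sizes $\gamma(k)$. The counter $k$ is incremented each time $x$ is updated. For the update of $x(k)$, $d(k)$ denotes the time at which the point used to compute the averaged gradient was read from the shared memory, so $0\le d(k)\le k$; the delay $\tau(k):=k-d(k)$ satisfies $0\le\tau(k)\le\tau_{\max}$ for all $k\in\mathbb{N}_0$, where $\tau_{\max}$ is a nonnegative integer. At update $k$, with samples $\xi_1(k),\dots,\xi_b(k)$ drawn i.i.d. from $\mathcal{P}$ (each query of the sampling oracle generates a new i.i.d. sample), $$g_{\mathrm{ave}}(d(k))=\frac1b\sum_{i=1}^b\nabla_xF\bigl(x(d(k)),\xi_i(k)\bigr),\qquad x(k+1)=\operatorname*{argmin}_z\Bigl\{\langle g_{\mathrm{ave}}(d(k)),z\rangle+\Psi(z)+\frac1{\gamma(k)}D_\omega(x(k),z)\Bigr\}.$$ The expectation in the claim is with respect to all random variables $\xi_i(k)$, $i=1,\dots,b$, $k=0,\dots,T-1$. *)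

theory Defs
  imports "HOL-Probability.Probability"
begin

definition is_norm :: "('a::real_vector \<Rightarrow> real) \<Rightarrow> bool" where
  "is_norm N \<longleftrightarrow>
     (\<forall>x. 0 \<le> N x) \<and> (\<forall>x. N x = 0 \<longleftrightarrow> x = 0) \<and>
     (\<forall>r x. N (r *\<^sub>R x) = \<bar>r\<bar> * N x) \<and> (\<forall>x y. N (x + y) \<le> N x + N y)"

definition dual_norm :: "('a::real_inner \<Rightarrow> real) \<Rightarrow> 'a \<Rightarrow> real" where
  "dual_norm N y = (SUP x\<in>{x. N x \<le> 1}. inner x y)"

definition is_max :: "'a::order set \<Rightarrow> 'a \<Rightarrow> bool" where
  "is_max S m \<longleftrightarrow> m \<in> S \<and> (\<forall>s\<in>S. s \<le> m)"

definition effective_domain :: "('a \<Rightarrow> ereal) \<Rightarrow> 'a set" where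
  "effective_domain \<Psi> = {x. \<Psi> x < \<infinity>}"

definition proper :: "('a \<Rightarrow> ereal) \<Rightarrow> bool" where
  "proper \<Psi> \<longleftrightarrow> (\<forall>x. \<Psi> x \<noteq> -\<infinity>) \<and> effective_domain \<Psi> \<noteq> {}"

(* At t = 0 and t = 1 the inequality is trivial, because 0 * \<infinity> = 0 in ereal. *)
definition ereal_convex :: "('a::real_vector \<Rightarrow> ereal) \<Rightarrow> bool" where
  "ereal_convex \<Psi> \<longleftrightarrow>
     (\<forall>x y. \<forall>t\<in>{0..1}.
        \<Psi> ((1 - t) *\<^sub>R x + t *\<^sub>R y) \<le> ereal (1 - t) * \<Psi> x + ereal t * \<Psi> y)"

definition lower_semicontinuous :: "('a::topological_space \<Rightarrow> ereal) \<Rightarrow> bool" where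
  "lower_semicontinuous \<Psi> \<longleftrightarrow> (\<forall>x. \<Psi> x \<le> Liminf (at x) \<Psi>)"

(* \<omega> and its gradient g\<omega> matter only on X.  The derivative is taken within X, since X need
   not be open. *)
definition distance_generating ::
  "('a::euclidean_space \<Rightarrow> real) \<Rightarrow> 'a set \<Rightarrow> ('a \<Rightarrow> real) \<Rightarrow> ('a \<Rightarrow> 'a) \<Rightarrow> bool" where
  "distance_generating N X \<omega> g\<omega> \<longleftrightarrow>
     (\<forall>x\<in>X. (\<omega> has_derivative (\<lambda>h. inner (g\<omega> x) h)) (at x within X)) \<and>
     continuous_on X g\<omega> \<and>
     (\<forall>x\<in>X. \<forall>y\<in>X. \<omega> y \<ge> \<omega> x + inner (g\<omega> x) (y - x) + 1 / 2 * (N (y - x))\<^sup>2)"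

definition bregman ::
  "('a::real_inner \<Rightarrow> real) \<Rightarrow> ('a \<Rightarrow> 'a) \<Rightarrow> 'a \<Rightarrow> 'a \<Rightarrow> real" where
  "bregman \<omega> g\<omega> x y = \<omega> y - \<omega> x - inner (g\<omega> x) (y - x)"

(* e2ennreal maps negative values to 0, so this is the expectation of the positive part minus
   that of the negative part.  If both are infinite the value is \<infinity>. *)
definition ereal_expectation :: "'w measure \<Rightarrow> ('w \<Rightarrow> ereal) \<Rightarrow> ereal" where
  "ereal_expectation M Y =
     enn2ereal (\<integral>\<^sup>+w. e2ennreal (Y w) \<partial>M) - enn2ereal (\<integral>\<^sup>+w. e2ennreal (- Y w) \<partial>M)"

end

theory Submission
  imports Defs
begin

text \<open>
  On the domain \<open>K\<close> of \<open>\<Psi>\<close>, which is compact and convex, the update is a mirror step, and its optimality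
  condition gives the three-point inequality. Together with convexity and smoothness of \<open>f\<close> at the
  delayed point \<open>x (d k)\<close> it bounds the gap \<open>\<phi> (x (Suc k)) - \<phi> z\<close> for a minimizer \<open>z\<close> by four terms: a
  weighted difference of Bregman distances to \<open>z\<close>, the delay penalty
  \<open>L / 2 * (N (x (Suc k) - x (d k)))\<^sup>2\<close>, minus \<open>1 / \<gamma> k\<close> times the Bregman length of the step, and the
  product of the gradient error with \<open>x (Suc k) - z\<close>. The two summands of \<open>1 / \<gamma> k\<close> split the step length.
  Summed over time, every single step lies in at most \<open>\<tau>max + 1\<close> delay windows, so the part with
  \<open>L * (\<tau>max + 1)\<^sup>2\<close> absorbs all delay penalties. The part with \<open>\<alpha> k\<close> is left for the gradient error.
  The Bregman differences telescope, because \<open>1 / \<gamma> k\<close> increases and the distances lie in \<open>[0, R\<^sup>2]\<close>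
  (lemma \<open>asynchronous_regret\<close>).

  The error term is handled by duality. The maximum of \<open>- e \<bullet> (y - z) - \<alpha> * bregman \<omega> g\<omega> u y\<close> over \<open>y\<close>
  in \<open>K\<close> is \<open>\<alpha>\<close> times an increment of the convex conjugate of \<open>\<omega>\<close> on \<open>K\<close>, plus \<open>e \<bullet> z\<close>. Strong
  convexity of \<open>\<omega>\<close> makes this conjugate smooth for the dual norm (lemma \<open>conjugate_smooth\<close>). Hence the
  \<open>b\<close> samples of a batch can be added one at a time: the first-order term of each is a product of a
  variable known beforehand with centered independent noise, so it has mean zero, and the
  second-order term is at most \<open>\<sigma>\<^sup>2 / (2 * \<alpha>\<^sup>2 * b\<^sup>2)\<close> in mean. A batch therefore costs at most
  \<open>\<sigma>\<^sup>2 / (2 * \<alpha> * b)\<close>, whatever the norm (lemma \<open>minibatch_noise\<close>). A bound on the squared dual norm of the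
  averaged error would instead bring in a constant that depends on the geometry of the norm.
  With the given \<open>\<alpha> k\<close> and \<open>c \<ge> 1\<close>, these costs sum to at most \<open>\<sigma> * R * sqrt (c * T / b)\<close>, and the
  telescoped \<open>\<alpha>\<close>-part is the same number.

  The mean-zero argument needs \<open>x k\<close> to depend only on earlier samples. The update determines
  \<open>x (Suc k)\<close> as a Lipschitz function of the dual point \<open>g\<omega> (x k) - \<gamma> k *\<^sub>R g_ave k\<close>, so by induction every
  iterate is almost surely a Borel function of the samples drawn before (lemma \<open>iterate_adapted\<close>).
  The claim follows by Jensen's inequality for the average.
\<close>

section \<open>Norms and dual norms\<close>

lemma is_norm_zero: "is_norm N \<Longrightarrow> N 0 = 0"
  by (simp add: is_norm_def)

lemma is_norm_minus: assumes "is_norm N" shows "N (- x) = N x"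
proof -
  have "N ((-1) *\<^sub>R x) = \<bar>-1\<bar> * N x" using assms unfolding is_norm_def by blast
  then show ?thesis by simp
qed

lemma is_norm_commute: "is_norm N \<Longrightarrow> N (x - y) = N (y - x)"
  by (metis is_norm_minus minus_diff_eq)

lemma is_norm_le_norm:
  fixes N :: "'a::euclidean_space \<Rightarrow> real"
  assumes N: "is_norm N"
  obtains C where "0 < C" "\<And>x. N x \<le> C * norm x"
proof
  let ?C = "1 + (\<Sum>i\<in>Basis. N i)"
  have nonneg: "\<And>x. 0 \<le> N x" using N by (simp add: is_norm_def)
  then show "0 < ?C" by (simp add: add_pos_nonneg sum_nonneg)
  fix x :: 'a
  have sum_le: "N (\<Sum>i\<in>B. h i) \<le> (\<Sum>i\<in>B. N (h i))" if "finite B" for B :: "'a set" and h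
    using that
  proof induction
    case empty
    then show ?case by (simp add: is_norm_zero[OF N])
  next
    case (insert i B)
    have "N (h i + sum h B) \<le> N (h i) + N (sum h B)" using N by (simp add: is_norm_def)
    with insert show ?case by simp
  qed
  have "N x = N (\<Sum>i\<in>Basis. (x \<bullet> i) *\<^sub>R i)" by (simp add: euclidean_representation)
  also have "\<dots> \<le> (\<Sum>i\<in>Basis. N ((x \<bullet> i) *\<^sub>R i))" by (rule sum_le) simp
  also have "\<dots> = (\<Sum>i\<in>Basis. \<bar>x \<bullet> i\<bar> * N i)" using N by (simp add: is_norm_def)
  also have "\<dots> \<le> (\<Sum>i\<in>Basis. norm x * N i)"
    by (intro sum_mono mult_right_mono Basis_le_norm nonneg)
  also have "\<dots> \<le> ?C * norm x" by (simp add: sum_distrib_left algebra_simps)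
  finally show "N x \<le> ?C * norm x" .
qed

lemma continuous_on_is_norm:
  fixes N :: "'a::euclidean_space \<Rightarrow> real"
  assumes N: "is_norm N"
  shows "continuous_on A N"
proof -
  obtain C where C: "0 < C" "\<And>x. N x \<le> C * norm x" using is_norm_le_norm[OF N] by blast
  have tri: "N x \<le> N y + N (x - y)" for x y
    using N unfolding is_norm_def by (metis add.commute diff_add_cancel)
  have "dist (N x) (N y) \<le> C * dist x y" for x y
    using tri[of x y] tri[of y x] C(2)[of "x - y"] is_norm_commute[OF N, of x y]
    by (simp add: dist_real_def dist_norm)
  then have "C-lipschitz_on A N" using C(1) by (intro lipschitz_onI) auto
  then show ?thesis by (rule lipschitz_on_continuous_on)
qed

text \<open>By compactness of the Euclidean unit sphere: \<open>N\<close> attains a positive minimum there. This makes the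
  unit ball of \<open>N\<close> bounded, so that the supremum in \<open>dual_norm\<close> is a genuine one.\<close>
lemma norm_le_is_norm:
  fixes N :: "'a::euclidean_space \<Rightarrow> real"
  assumes N: "is_norm N"
  obtains C where "0 < C" "\<And>x. norm x \<le> C * N x"
proof -
  have "\<exists>x\<in>sphere 0 1. \<forall>y\<in>sphere 0 1. N x \<le> N (y::'a)"
    by (rule continuous_attains_inf) (auto intro: continuous_on_is_norm[OF N])
  then obtain x :: 'a where x: "norm x = 1" and min: "\<And>y. norm y = 1 \<Longrightarrow> N x \<le> N y" by auto
  have pos: "0 < N x"
    using N x unfolding is_norm_def by (metis less_eq_real_def norm_zero zero_neq_one)
  have "norm y \<le> (1 / N x) * N y" for y
  proof (cases "y = 0")
    case True
    then show ?thesis using N by (simp add: is_norm_zero)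
  next
    case False
    then have "N x \<le> N ((1 / norm y) *\<^sub>R y)" by (intro min) simp
    also have "\<dots> = N y / norm y" using N by (simp add: is_norm_def)
    finally show ?thesis using False pos by (simp add: field_simps)
  qed
  with pos show thesis by (intro that[of "1 / N x"]) auto
qed

context
  fixes N :: "'a::euclidean_space \<Rightarrow> real"
  assumes N: "is_norm N"
begin

lemma bdd_above_dual_norm: "bdd_above ((\<lambda>x. x \<bullet> y) ` {x. N x \<le> 1})"
proof -
  obtain C where C: "0 < C" "\<And>x. norm x \<le> C * N x" using norm_le_is_norm[OF N] by blast
  have "x \<bullet> y \<le> C * norm y" if "N x \<le> 1" for x
  proof -
    have "norm x \<le> C" using C(2)[of x] that C(1) by (smt (verit) mult_left_le)
    then have "norm x * norm y \<le> C * norm y" by (simp add: mult_right_mono)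
    then show ?thesis using norm_cauchy_schwarz[of x y] by linarith
  qed
  then show ?thesis by (intro bdd_aboveI2[where M="C * norm y"]) auto
qed

lemma inner_le_dual_norm: "x \<bullet> y \<le> N x * dual_norm N y"
proof (cases "x = 0")
  case True
  then show ?thesis by (simp add: is_norm_zero[OF N])
next
  case False
  then have pos: "0 < N x" using N unfolding is_norm_def by (metis less_eq_real_def)
  have "N ((1 / N x) *\<^sub>R x) = \<bar>1 / N x\<bar> * N x" using N unfolding is_norm_def by blast
  then have "N ((1 / N x) *\<^sub>R x) \<le> 1" using pos by simp
  then have "((1 / N x) *\<^sub>R x) \<bullet> y \<le> dual_norm N y"
    unfolding dual_norm_def by (intro cSUP_upper bdd_above_dual_norm) simp
  then show ?thesis using pos by (simp add: field_simps)
qed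

lemma dual_norm_nonneg: "0 \<le> dual_norm N y"
proof -
  have "(0::'a) \<bullet> y \<le> dual_norm N y"
    unfolding dual_norm_def by (intro cSUP_upper bdd_above_dual_norm) (simp add: is_norm_zero[OF N])
  then show ?thesis by simp
qed

lemma dual_norm_le:
  assumes "\<And>x. N x \<le> 1 \<Longrightarrow> x \<bullet> y \<le> B"
  shows "dual_norm N y \<le> B"
  unfolding dual_norm_def
proof (rule cSUP_least)
  show "{x. N x \<le> 1} \<noteq> {}" using is_norm_zero[OF N] by (metis (mono_tags) empty_Collect_eq zero_le_one)
qed (use assms in auto)

lemma dual_norm_scale: "dual_norm N (r *\<^sub>R y) \<le> \<bar>r\<bar> * dual_norm N y"
proof (rule dual_norm_le)
  fix x assume x: "N x \<le> 1"
  have "(r *\<^sub>R x) \<bullet> y \<le> N (r *\<^sub>R x) * dual_norm N y" by (rule inner_le_dual_norm)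
  also have "N (r *\<^sub>R x) = \<bar>r\<bar> * N x" using N by (simp add: is_norm_def)
  also have "\<bar>r\<bar> * N x * dual_norm N y \<le> \<bar>r\<bar> * 1 * dual_norm N y"
    by (intro mult_right_mono mult_left_mono x dual_norm_nonneg) auto
  finally show "x \<bullet> (r *\<^sub>R y) \<le> \<bar>r\<bar> * dual_norm N y" by simp
qed

lemma dual_norm_le_norm:
  obtains C where "0 < C" "\<And>y. dual_norm N y \<le> C * norm y"
proof -
  obtain C where C: "0 < C" "\<And>x. norm x \<le> C * N x" using norm_le_is_norm[OF N] by blast
  have "dual_norm N y \<le> C * norm y" for y
  proof (rule dual_norm_le)
    fix x assume "N x \<le> 1"
    then have "norm x \<le> C" using C(2)[of x] C(1) by (smt (verit) mult_left_le)
    then have "norm x * norm y \<le> C * norm y" by (simp add: mult_right_mono)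
    then show "x \<bullet> y \<le> C * norm y" using norm_cauchy_schwarz[of x y] by linarith
  qed
  with C(1) show thesis by (rule that)
qed

text \<open>Test the duality inequality with \<open>y\<close> against itself.\<close>
lemma norm_le_dual_norm:
  obtains C where "0 < C" "\<And>y. norm y \<le> C * dual_norm N y"
proof -
  obtain C where C: "0 < C" "\<And>x. N x \<le> C * norm x" using is_norm_le_norm[OF N] by blast
  have "norm y \<le> C * dual_norm N y" for y
  proof (cases "y = 0")
    case True
    then show ?thesis using C(1) dual_norm_nonneg by simp
  next
    case False
    have "norm y * norm y = y \<bullet> y" by (simp add: power2_norm_eq_inner flip: power2_eq_square)
    also have "\<dots> \<le> N y * dual_norm N y" by (rule inner_le_dual_norm)
    also have "\<dots> \<le> C * norm y * dual_norm N y" by (intro mult_right_mono C dual_norm_nonneg)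
    finally show ?thesis using False by (simp add: mult_ac)
  qed
  with C(1) show thesis by (rule that)
qed

text \<open>A supremum of linear forms that are uniformly Lipschitz is Lipschitz.\<close>
lemma continuous_on_dual_norm: "continuous_on A (dual_norm N)"
proof -
  obtain C where C: "0 < C" "\<And>x. dual_norm N x \<le> C * norm x" using dual_norm_le_norm by blast
  have tri: "dual_norm N x \<le> dual_norm N y + dual_norm N (x - y)" for x y
  proof (rule dual_norm_le)
    fix z assume z: "N z \<le> 1"
    have "z \<bullet> v \<le> dual_norm N v" for v
      using z unfolding dual_norm_def by (intro cSUP_upper bdd_above_dual_norm) simp
    from this[of y] this[of "x - y"] show "z \<bullet> x \<le> dual_norm N y + dual_norm N (x - y)"
      by (simp add: inner_diff_right)
  qed
  have "dist (dual_norm N x) (dual_norm N y) \<le> C * dist x y" for x y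
    using tri[of x y] tri[of y x] C(2)[of "x - y"] C(2)[of "y - x"]
    by (simp add: dist_real_def dist_norm norm_minus_commute)
  then have "C-lipschitz_on A (dual_norm N)" using C(1) by (intro lipschitz_onI) auto
  then show ?thesis by (rule lipschitz_on_continuous_on)
qed

lemma borel_measurable_dual_norm [measurable]: "dual_norm N \<in> borel_measurable borel"
  by (intro borel_measurable_continuous_onI continuous_on_dual_norm)

end

section \<open>Bregman distances and the conjugate of the generating function\<close>

lemma convex_on_inner: "convex K \<Longrightarrow> convex_on K (\<lambda>z. p \<bullet> z)"
  by (simp add: convex_on_def inner_add_right)

text \<open>The situation on the domain of \<open>\<Psi>\<close>: \<open>K\<close> is that domain, and \<open>\<omega>\<close> has modulus 1 there with respect
  to \<open>N\<close>. Only derivatives within \<open>K\<close> occur, since \<open>K\<close> may have empty interior.\<close>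
locale compact_mirror_map =
  fixes N :: "'a::euclidean_space \<Rightarrow> real" and K :: "'a set"
    and \<omega> :: "'a \<Rightarrow> real" and g\<omega> :: "'a \<Rightarrow> 'a"
  assumes norm: "is_norm N"
    and compact_K: "compact K" and convex_K: "convex K" and nonempty_K: "K \<noteq> {}"
    and has_gradient: "\<And>x. x \<in> K \<Longrightarrow> (\<omega> has_derivative (\<lambda>h. g\<omega> x \<bullet> h)) (at x within K)"
    and continuous_gradient: "continuous_on K g\<omega>"
    and half_norm_le_bregman: "\<And>x y. x \<in> K \<Longrightarrow> y \<in> K \<Longrightarrow> (N (y - x))\<^sup>2 / 2 \<le> bregman \<omega> g\<omega> x y"
begin

lemma bregman_nonneg: "x \<in> K \<Longrightarrow> y \<in> K \<Longrightarrow> 0 \<le> bregman \<omega> g\<omega> x y"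
  using half_norm_le_bregman[of x y] zero_le_power2[of "N (y - x)"] by linarith

text \<open>Move from \<open>y\<close> towards \<open>z\<close>: since \<open>y\<close> is a minimizer, the difference quotients of \<open>\<omega>\<close> along the
  segment stay above \<open>\<psi> y - \<psi> z\<close>, and hence so does the derivative of \<open>\<omega>\<close> in that direction.\<close>
lemma three_point_inequality:
  assumes \<psi>: "convex_on K \<psi>" and y: "is_arg_min (\<lambda>z. \<psi> z + \<omega> z) (\<lambda>z. z \<in> K) y" and z: "z \<in> K"
  shows "\<psi> y + \<omega> y + bregman \<omega> g\<omega> y z \<le> \<psi> z + \<omega> z"
proof -
  have yK: "y \<in> K" and min: "\<And>z. z \<in> K \<Longrightarrow> \<psi> y + \<omega> y \<le> \<psi> z + \<omega> z"
    using y by (auto simp: is_arg_min_linorder)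
  define line where "line t = y + t *\<^sub>R (z - y)" for t :: real
  have line_K: "line t \<in> K" if "t \<in> {0..1}" for t
    using convexD[OF convex_K yK z, of "1 - t" t] that by (simp add: line_def algebra_simps)
  have "((\<lambda>t. \<omega> (line t)) has_derivative (\<lambda>h. g\<omega> y \<bullet> (h *\<^sub>R (z - y)))) (at 0 within {0..1})"
  proof (rule has_derivative_in_compose2[of K \<omega> "\<lambda>y h. g\<omega> y \<bullet> h" line "{0..1}" 0, THEN has_derivative_eq_rhs])
    show "(line has_derivative (\<lambda>h. h *\<^sub>R (z - y))) (at 0 within {0..1})"
      unfolding line_def by (auto intro!: derivative_eq_intros)
  qed (use line_K has_gradient in \<open>auto simp: line_def\<close>)
  then have "((\<lambda>t. \<omega> (line t)) has_real_derivative g\<omega> y \<bullet> (z - y)) (at 0 within {0..1})"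
    by (simp add: has_field_derivative_def mult.commute[of _ "g\<omega> y \<bullet> (z - y)"])
  then have "((\<lambda>t. (\<omega> (line t) - \<omega> y) / t) \<longlongrightarrow> g\<omega> y \<bullet> (z - y)) (at 0 within {0..1})"
    by (simp add: has_field_derivative_iff line_def)
  moreover have "\<forall>\<^sub>F t in at 0 within {0..1}. \<psi> y - \<psi> z \<le> (\<omega> (line t) - \<omega> y) / t"
    unfolding eventually_at
  proof (intro exI[of _ 1] conjI ballI impI)
    fix t :: real
    assume "t \<in> {0..1}" "t \<noteq> 0 \<and> dist t 0 < 1"
    then have t: "0 < t" "t \<le> 1" by auto
    have "\<psi> (line t) \<le> (1 - t) * \<psi> y + t * \<psi> z"
      using convex_onD[OF \<psi>, of t y z] yK z t by (simp add: line_def algebra_simps)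
    moreover have "\<psi> y + \<omega> y \<le> \<psi> (line t) + \<omega> (line t)"
      using line_K t by (intro min) auto
    ultimately have "t * (\<psi> y - \<psi> z) \<le> \<omega> (line t) - \<omega> y" by (simp add: algebra_simps)
    with t show "\<psi> y - \<psi> z \<le> (\<omega> (line t) - \<omega> y) / t" by (simp add: field_simps)
  qed simp
  moreover have "at 0 within {0..1::real} \<noteq> bot"
    by (simp add: trivial_limit_within islimpt_Icc)
  ultimately have "\<psi> y - \<psi> z \<le> g\<omega> y \<bullet> (z - y)"
    by (rule tendsto_lowerbound)
  then show ?thesis by (simp add: bregman_def)
qed

text \<open>Two three-point inequalities added up, with each minimizer compared against the other one.\<close>
lemma argmin_nonexpansive:
  assumes \<psi>: "convex_on K \<psi>"
    and y: "is_arg_min (\<lambda>z. \<psi> z - p \<bullet> z + \<omega> z) (\<lambda>z. z \<in> K) y"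
    and y': "is_arg_min (\<lambda>z. \<psi> z - p' \<bullet> z + \<omega> z) (\<lambda>z. z \<in> K) y'"
  shows "N (y - y') \<le> dual_norm N (p - p')"
proof -
  have yK: "y \<in> K" "y' \<in> K" using y y' by (auto simp: is_arg_min_linorder)
  have cvx: "convex_on K (\<lambda>z. \<psi> z - q \<bullet> z)" for q
  proof -
    have "convex_on K (\<lambda>z. (- q) \<bullet> z)"
      by (rule convex_on_inner[OF convex_K])
    from convex_on_add[OF \<psi> this] show ?thesis by simp
  qed
  have "(N (y - y'))\<^sup>2 / 2 + (N (y - y'))\<^sup>2 / 2 \<le> bregman \<omega> g\<omega> y' y + bregman \<omega> g\<omega> y y'"
    using half_norm_le_bregman[OF yK] half_norm_le_bregman[OF yK(2,1)] is_norm_commute[OF norm, of y y']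
    by simp
  also have "\<dots> \<le> (y - y') \<bullet> (p - p')"
    using three_point_inequality[OF cvx y yK(2)] three_point_inequality[OF cvx y' yK(1)]
    by (simp add: inner_diff inner_commute)
  also have "\<dots> \<le> N (y - y') * dual_norm N (p - p')" by (rule inner_le_dual_norm[OF norm])
  finally have "N (y - y') * N (y - y') \<le> N (y - y') * dual_norm N (p - p')"
    by (simp add: power2_eq_square)
  moreover have "0 \<le> N (y - y')" using norm by (simp add: is_norm_def)
  ultimately show ?thesis
    by (metis dual_norm_nonneg[OF norm] less_eq_real_def mult_le_cancel_left_pos)
qed

lemma argmin_lipschitz:
  obtains B where "0 < B" and "\<And>\<psi> p p' y y'. convex_on K \<psi> \<Longrightarrow>
      is_arg_min (\<lambda>z. \<psi> z - p \<bullet> z + \<omega> z) (\<lambda>z. z \<in> K) y \<Longrightarrow>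
      is_arg_min (\<lambda>z. \<psi> z - p' \<bullet> z + \<omega> z) (\<lambda>z. z \<in> K) y' \<Longrightarrow> dist y y' \<le> B * dist p p'"
proof -
  obtain C where C: "0 < C" "\<And>y. dual_norm N y \<le> C * norm y" using dual_norm_le_norm[OF norm] by blast
  obtain C' where C': "0 < C'" "\<And>x. norm x \<le> C' * N x" using norm_le_is_norm[OF norm] by blast
  show thesis
  proof (rule that[of "C' * C"])
    fix \<psi> p p' y y'
    assume *: "convex_on K \<psi>"
      "is_arg_min (\<lambda>z. \<psi> z - p \<bullet> z + \<omega> z) (\<lambda>z. z \<in> K) y"
      "is_arg_min (\<lambda>z. \<psi> z - p' \<bullet> z + \<omega> z) (\<lambda>z. z \<in> K) y'"
    have "norm (y - y') \<le> C' * N (y - y')" by (rule C')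
    also have "\<dots> \<le> C' * (C * norm (p - p'))"
      using argmin_nonexpansive[OF *] C(2)[of "p - p'"] C'(1) by (intro mult_left_mono) auto
    finally show "dist y y' \<le> C' * C * dist p p'" by (simp add: dist_norm)
  qed (use C C' in simp)
qed

text \<open>The update is known only through the property of being a minimizer, which may fail to exist for
  some \<open>p\<close>. Where it exists it is a Lipschitz function of \<open>p\<close>, so it extends continuously to the
  closure of that set, and by 0 to a Borel function on the whole space.\<close>
lemma borel_argmin_selector:
  assumes \<psi>: "convex_on K \<psi>"
  obtains T where "T \<in> borel_measurable borel"
    and "\<And>p y. is_arg_min (\<lambda>z. \<psi> z - p \<bullet> z + \<omega> z) (\<lambda>z. z \<in> K) y \<Longrightarrow> T p = y"
proof -
  let ?argmin = "\<lambda>p y. is_arg_min (\<lambda>z. \<psi> z - p \<bullet> z + \<omega> z) (\<lambda>z. z \<in> K) y"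
  obtain B where B: "0 < B" "\<And>p p' y y'. ?argmin p y \<Longrightarrow> ?argmin p' y' \<Longrightarrow> dist y y' \<le> B * dist p p'"
    by (rule argmin_lipschitz) (use \<psi> in blast)
  define S where "S = {p. \<exists>y. ?argmin p y}"
  define t where "t p = (SOME y. ?argmin p y)" for p
  have t: "?argmin p (t p)" if "p \<in> S" for p
    using that unfolding S_def t_def by (auto intro: someI)
  have "B-lipschitz_on S t" using B t by (intro lipschitz_onI) auto
  then have "uniformly_continuous_on S t" by (rule lipschitz_on_uniformly_continuous)
  then obtain T where T: "uniformly_continuous_on (closure S) T" "\<And>p. p \<in> S \<Longrightarrow> t p = T p"
    by (rule uniformly_continuous_on_extension_on_closure) blast
  show thesis
  proof (rule that)
    show "(\<lambda>p. indicator (closure S) p *\<^sub>R T p) \<in> borel_measurable borel"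
      by (intro borel_measurable_continuous_on_indicator uniformly_continuous_imp_continuous T) auto
    fix p y
    assume y: "?argmin p y"
    then have S: "p \<in> S" by (auto simp: S_def)
    with closure_subset have "p \<in> closure S" by blast
    moreover have "t p = y" using B(2)[OF t[OF S] y] by simp
    ultimately show "indicator (closure S) p *\<^sub>R T p = y" using T(2)[OF S] by simp
  qed
qed

lemma continuous_on_dgf: "continuous_on K \<omega>"
  using has_gradient by (auto simp: continuous_on_eq_continuous_within intro: has_derivative_continuous)

text \<open>The gradient of the convex function \<open>conjugate\<close>.\<close>
definition mirror :: "'a \<Rightarrow> 'a" where
  "mirror p = (SOME y. is_arg_min (\<lambda>z. \<omega> z - p \<bullet> z) (\<lambda>z. z \<in> K) y)"

text \<open>The Fenchel conjugate of \<open>\<omega>\<close> restricted to \<open>K\<close>, with the supremum written as its attained value.\<close>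
definition conjugate :: "'a \<Rightarrow> real" where
  "conjugate p = p \<bullet> mirror p - \<omega> (mirror p)"

lemma mirror_is_arg_min: "is_arg_min (\<lambda>z. \<omega> z - p \<bullet> z) (\<lambda>z. z \<in> K) (mirror p)"
proof -
  have "continuous_on K (\<lambda>z. \<omega> z - p \<bullet> z)" by (intro continuous_intros continuous_on_dgf)
  from continuous_attains_inf[OF compact_K nonempty_K this]
  obtain y where "is_arg_min (\<lambda>z. \<omega> z - p \<bullet> z) (\<lambda>z. z \<in> K) y"
    by (auto simp: is_arg_min_linorder)
  then show ?thesis unfolding mirror_def by (rule someI)
qed

lemma mirror_in_K: "mirror p \<in> K"
  using mirror_is_arg_min[of p] by (simp add: is_arg_min_linorder)

lemma inner_minus_dgf_le_conjugate: "z \<in> K \<Longrightarrow> p \<bullet> z - \<omega> z \<le> conjugate p"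
  using mirror_is_arg_min[of p] by (fastforce simp: is_arg_min_linorder conjugate_def)

lemma continuous_on_mirror: "continuous_on A mirror"
proof -
  obtain B where B: "0 < B" "\<And>\<psi> p p' y y'. convex_on K \<psi> \<Longrightarrow>
      is_arg_min (\<lambda>z. \<psi> z - p \<bullet> z + \<omega> z) (\<lambda>z. z \<in> K) y \<Longrightarrow>
      is_arg_min (\<lambda>z. \<psi> z - p' \<bullet> z + \<omega> z) (\<lambda>z. z \<in> K) y' \<Longrightarrow> dist y y' \<le> B * dist p p'"
    using argmin_lipschitz by blast
  have min: "is_arg_min (\<lambda>z. 0 - p \<bullet> z + \<omega> z) (\<lambda>z. z \<in> K) (mirror p)" for p
    using mirror_is_arg_min[of p] by (simp add: is_arg_min_linorder)
  have "convex_on K (\<lambda>_. 0)" using convex_K by (simp add: convex_on_const)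
  from B(2)[OF this min min] B(1) have "B-lipschitz_on A mirror"
    by (intro lipschitz_onI) auto
  then show ?thesis by (rule lipschitz_on_continuous_on)
qed

lemma continuous_on_conjugate: "continuous_on A conjugate"
  unfolding conjugate_def
  using mirror_in_K
  by (intro continuous_intros continuous_on_mirror continuous_on_compose2[OF continuous_on_dgf]) auto

text \<open>Equality in Fenchel's inequality at the gradient of \<open>\<omega>\<close>: the gap is a Bregman distance.\<close>
lemma conjugate_gradient:
  assumes "u \<in> K" shows "conjugate (g\<omega> u) \<le> g\<omega> u \<bullet> u - \<omega> u"
  using bregman_nonneg[OF assms mirror_in_K, of "g\<omega> u"]
  by (simp add: conjugate_def bregman_def inner_diff_right)

text \<open>Duality between strong convexity and smoothness: with \<open>y = mirror p\<close> and \<open>z = mirror (p + q)\<close>, the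
  three-point inequality gains \<open>(N (z - y))\<^sup>2 / 2\<close>. This pays for the pairing of \<open>q\<close> with \<open>z - y\<close> up to
  \<open>(dual_norm N q)\<^sup>2 / 2\<close>.\<close>
lemma conjugate_smooth:
  "conjugate (p + q) \<le> conjugate p + q \<bullet> mirror p + (dual_norm N q)\<^sup>2 / 2"
proof -
  let ?y = "mirror p" and ?z = "mirror (p + q)"
  have "is_arg_min (\<lambda>z. - (p \<bullet> z) + \<omega> z) (\<lambda>z. z \<in> K) ?y"
    using mirror_is_arg_min[of p] by (simp add: is_arg_min_linorder)
  moreover have "convex_on K (\<lambda>z. (- p) \<bullet> z)"
    by (rule convex_on_inner[OF convex_K])
  ultimately have "- (p \<bullet> ?y) + \<omega> ?y + bregman \<omega> g\<omega> ?y ?z \<le> - (p \<bullet> ?z) + \<omega> ?z"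
    using mirror_in_K by (intro three_point_inequality) auto
  moreover have "(N (?z - ?y))\<^sup>2 / 2 \<le> bregman \<omega> g\<omega> ?y ?z"
    by (intro half_norm_le_bregman mirror_in_K)
  moreover have "q \<bullet> (?z - ?y) \<le> N (?z - ?y) * dual_norm N q"
    using inner_le_dual_norm[OF norm, of "?z - ?y" q] by (simp add: inner_commute)
  moreover have "N (?z - ?y) * dual_norm N q \<le> (N (?z - ?y))\<^sup>2 / 2 + (dual_norm N q)\<^sup>2 / 2"
    using sum_squares_bound[of "N (?z - ?y)" "dual_norm N q"] by simp
  ultimately show ?thesis by (simp add: conjugate_def inner_diff_right inner_add_left)
qed

lemma conjugate_bounds:
  obtains r s where "0 \<le> r" "\<And>p. \<bar>conjugate p\<bar> \<le> r * norm p + s"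
proof -
  from compact_imp_bounded[OF compact_K] obtain r where r: "0 < r" "\<And>x. x \<in> K \<Longrightarrow> norm x \<le> r"
    by (auto simp: bounded_pos)
  from compact_imp_bounded[OF compact_continuous_image[OF continuous_on_dgf compact_K]]
  obtain s where s: "\<And>x. x \<in> K \<Longrightarrow> \<bar>\<omega> x\<bar> \<le> s" by (auto simp: bounded_pos)
  have "\<bar>conjugate p\<bar> \<le> r * norm p + s" for p
  proof -
    have "\<bar>p \<bullet> mirror p\<bar> \<le> norm p * norm (mirror p)" by (rule Cauchy_Schwarz_ineq2)
    also have "\<dots> \<le> norm p * r" by (intro mult_left_mono r mirror_in_K) auto
    finally show ?thesis using s[OF mirror_in_K, of p] by (simp add: conjugate_def mult.commute)
  qed
  with r show thesis by (intro that[of r s]) auto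
qed

end

section \<open>Independent samples and their past\<close>

text \<open>The sigma-algebra generated by the samples with index in \<open>J\<close>, as a measure space so that the usual
  notion of measurability expresses dependence on these samples alone.\<close>
definition history :: "'w measure \<Rightarrow> 's measure \<Rightarrow> ('i \<Rightarrow> 'w \<Rightarrow> 's) \<Rightarrow> 'i set \<Rightarrow> 'w measure" where
  "history M P X J = vimage_algebra (space M) (\<lambda>w. \<lambda>i\<in>J. X i w) (\<Pi>\<^sub>M i\<in>J. P)"

locale iid_samples = prob_space M + P: prob_space P
  for M :: "'w measure" and P :: "'s measure" +
  fixes X :: "'i \<Rightarrow> 'w \<Rightarrow> 's" and I :: "'i set"
  assumes indep: "indep_vars (\<lambda>_. P) X I"
    and identical: "\<And>i. i \<in> I \<Longrightarrow> distr M P (X i) = P"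
begin

abbreviation past :: "'i set \<Rightarrow> 'w measure" where
  "past \<equiv> history M P X"

lemma sample_measurable: "i \<in> I \<Longrightarrow> X i \<in> measurable M P"
  using indep by (simp add: indep_vars_def)

lemma samples_measurable: "J \<subseteq> I \<Longrightarrow> (\<lambda>w. \<lambda>i\<in>J. X i w) \<in> measurable M (\<Pi>\<^sub>M i\<in>J. P)"
  by (intro measurable_restrict sample_measurable) auto

lemma space_past [simp]: "space (past J) = space M"
  by (simp add: history_def)

lemma sets_past: "J \<subseteq> I \<Longrightarrow> sets (past J) = {(\<lambda>w. \<lambda>i\<in>J. X i w) -` A \<inter> space M | A. A \<in> sets (\<Pi>\<^sub>M i\<in>J. P)}"
  unfolding history_def using samples_measurable
  by (intro sets_vimage_algebra2) (auto dest: measurable_space)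

lemma measurable_past_imp: "J \<subseteq> I \<Longrightarrow> Z \<in> measurable (past J) S \<Longrightarrow> Z \<in> measurable M S"
proof (rule measurable_from_subalg)
  assume "J \<subseteq> I"
  then show "subalgebra M (past J)"
    unfolding subalgebra_def by (auto simp: sets_past intro: measurable_sets[OF samples_measurable])
qed

lemma sample_measurable_past: "i \<in> J \<Longrightarrow> J \<subseteq> I \<Longrightarrow> X i \<in> measurable (past J) P"
proof -
  assume i: "i \<in> J" and J: "J \<subseteq> I"
  have "(\<lambda>w. \<lambda>i\<in>J. X i w) \<in> measurable (past J) (\<Pi>\<^sub>M i\<in>J. P)"
    unfolding history_def using samples_measurable[OF J]
    by (intro measurable_vimage_algebra1) (auto dest: measurable_space)
  from measurable_compose[OF this measurable_component_singleton[OF i]] show ?thesis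
    using i by simp
qed

lemma measurable_past_mono:
  assumes "J \<subseteq> J'" "J' \<subseteq> I" "Z \<in> measurable (past J) S"
  shows "Z \<in> measurable (past J') S"
proof (rule measurable_from_subalg[OF _ assms(3)])
  have "(\<lambda>w. \<lambda>i\<in>J. X i w) \<in> measurable (past J') (\<Pi>\<^sub>M i\<in>J. P)"
    using assms by (intro measurable_restrict sample_measurable_past) auto
  then show "subalgebra (past J') (past J)"
    using assms unfolding subalgebra_def
    by (auto simp: sets_past[of J] dest: measurable_sets)
qed

context
  fixes J j Z and S :: "'z measure"
  assumes J: "J \<subseteq> I" "j \<in> I - J" and Z: "Z \<in> measurable (past J) S"
begin

lemma measurable_past_sample_pair: "(\<lambda>w. (Z w, X j w)) \<in> measurable M (S \<Otimes>\<^sub>M P)"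
  using measurable_past_imp[OF J(1) Z] sample_measurable J by (intro measurable_Pair) auto

text \<open>Checked on rectangles: an event of the past and an event of \<open>X j\<close> are events of two disjoint
  groups of independent variables.\<close>
lemma distr_past_sample: "distr M (S \<Otimes>\<^sub>M P) (\<lambda>w. (Z w, X j w)) = distr M S Z \<Otimes>\<^sub>M P"
proof -
  have Z': "Z \<in> measurable M S" by (rule measurable_past_imp[OF J(1) Z])
  have X: "X j \<in> measurable M P" using J by (intro sample_measurable) auto
  interpret D: prob_space "distr M S Z" by (rule prob_space_distr[OF Z'])
  have "distr M S Z \<Otimes>\<^sub>M P = distr M (S \<Otimes>\<^sub>M P) (\<lambda>w. (Z w, X j w))"
  proof (rule pair_measure_eqI)
    show "sets (distr M S Z \<Otimes>\<^sub>M P) = sets (distr M (S \<Otimes>\<^sub>M P) (\<lambda>w. (Z w, X j w)))"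
      by (simp cong: sets_pair_measure_cong)
    fix A B
    assume "A \<in> sets (distr M S Z)" and B: "B \<in> sets P"
    then have A: "A \<in> sets S" by simp
    obtain A' where A': "A' \<in> sets (\<Pi>\<^sub>M i\<in>J. P)"
        "Z -` A \<inter> space M = (\<lambda>w. \<lambda>i\<in>J. X i w) -` A' \<inter> space M"
      using measurable_sets[OF Z A] unfolding sets_past[OF J(1)] by auto
    define B' where "B' = (\<lambda>f. f j) -` B \<inter> space (\<Pi>\<^sub>M i\<in>{j}. P)"
    have B': "B' \<in> sets (\<Pi>\<^sub>M i\<in>{j}. P)"
      unfolding B'_def using B by measurable
    have Xj: "X j -` B \<inter> space M = (\<lambda>w. \<lambda>i\<in>{j}. X i w) -` B' \<inter> space M"
      using measurable_space[OF X] by (auto simp: B'_def space_PiM PiE_def extensional_def Pi_def)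
    have "indep_var (\<Pi>\<^sub>M i\<in>J. P) (\<lambda>w. \<lambda>i\<in>J. X i w) (\<Pi>\<^sub>M i\<in>{j}. P) (\<lambda>w. \<lambda>i\<in>{j}. X i w)"
      using J by (intro indep_var_restrict[OF indep]) auto
    from indep_varD[OF this A'(1) B']
    have "prob ((Z -` A \<inter> space M) \<inter> (X j -` B \<inter> space M)) = prob (Z -` A \<inter> space M) * prob (X j -` B \<inter> space M)"
      unfolding A'(2) Xj by (simp add: vimage_def Int_def conj_ac)
    moreover have "emeasure (distr M S Z) A = prob (Z -` A \<inter> space M)"
      using A Z' by (simp add: emeasure_distr emeasure_eq_measure)
    moreover have "emeasure P B = prob (X j -` B \<inter> space M)"
      using emeasure_distr[OF X B] identical[of j] J by (simp add: emeasure_eq_measure)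
    moreover have "emeasure (distr M (S \<Otimes>\<^sub>M P) (\<lambda>w. (Z w, X j w))) (A \<times> B)
        = prob ((Z -` A \<inter> space M) \<inter> (X j -` B \<inter> space M))"
      using A B measurable_past_sample_pair
      by (subst emeasure_distr) (auto simp: emeasure_eq_measure intro!: arg_cong[where f=prob])
    ultimately show "emeasure (distr M S Z) A * emeasure P B
        = emeasure (distr M (S \<Otimes>\<^sub>M P) (\<lambda>w. (Z w, X j w))) (A \<times> B)"
      by (simp add: ennreal_mult)
  qed unfold_locales
  then show ?thesis by simp
qed

text \<open>A fresh sample may be integrated out first, with everything from the past held fixed. This
  and the next lemma are the only way in which independence is used.\<close>
lemma nn_integral_past_sample:
  assumes f: "f \<in> borel_measurable (S \<Otimes>\<^sub>M P)"
  shows "(\<integral>\<^sup>+w. f (Z w, X j w) \<partial>M) = (\<integral>\<^sup>+w. (\<integral>\<^sup>+s. f (Z w, s) \<partial>P) \<partial>M)"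
proof -
  have Z': "Z \<in> measurable M S" by (rule measurable_past_imp[OF J(1) Z])
  have "(\<integral>\<^sup>+w. f (Z w, X j w) \<partial>M) = (\<integral>\<^sup>+p. f p \<partial>(distr M S Z \<Otimes>\<^sub>M P))"
    unfolding distr_past_sample[symmetric] using f measurable_past_sample_pair
    by (simp add: nn_integral_distr)
  also have "\<dots> = (\<integral>\<^sup>+z. (\<integral>\<^sup>+s. f (z, s) \<partial>P) \<partial>distr M S Z)"
    using f by (intro P.nn_integral_fst[symmetric]) (simp cong: measurable_cong_sets sets_pair_measure_cong)
  also have "\<dots> = (\<integral>\<^sup>+w. (\<integral>\<^sup>+s. f (Z w, s) \<partial>P) \<partial>M)"
    using f by (intro nn_integral_distr Z' P.borel_measurable_nn_integral) (simp add: case_prod_beta')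
  finally show ?thesis .
qed

lemma integral_past_sample:
  fixes f :: "_ \<Rightarrow> real"
  assumes f: "f \<in> borel_measurable (S \<Otimes>\<^sub>M P)" and int: "integrable M (\<lambda>w. f (Z w, X j w))"
  shows "(LINT w|M. f (Z w, X j w)) = (LINT w|M. LINT s|P. f (Z w, s))"
proof -
  have Z': "Z \<in> measurable M S" by (rule measurable_past_imp[OF J(1) Z])
  interpret D: prob_space "distr M S Z" by (rule prob_space_distr[OF Z'])
  interpret pair_sigma_finite "distr M S Z" P ..
  have int': "integrable (distr M S Z \<Otimes>\<^sub>M P) f"
    unfolding distr_past_sample[symmetric] using f measurable_past_sample_pair int
    by (simp add: integrable_distr_eq)
  have "(LINT w|M. f (Z w, X j w)) = (LINT p|(distr M S Z \<Otimes>\<^sub>M P). f p)"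
    unfolding distr_past_sample[symmetric] using f measurable_past_sample_pair
    by (simp add: integral_distr)
  also have "\<dots> = (LINT z|distr M S Z. LINT s|P. f (z, s))"
    by (rule integral_fst[symmetric, of "\<lambda>z s. f (z, s)", simplified, OF int'])
  also have "\<dots> = (LINT w|M. LINT s|P. f (Z w, s))"
    using f by (intro integral_distr Z' P.borel_measurable_lebesgue_integral) (simp add: case_prod_beta')
  finally show ?thesis .
qed

end

end

section \<open>Noise of stochastic gradients\<close>

text \<open>The variance bound is uniform in the query point \<open>y\<close>, because the oracle is queried at random
  points. Joint measurability makes these queries random variables.\<close>
locale stochastic_gradient = iid_samples M P X I
  for M :: "'w measure" and P :: "'s measure" and X :: "'i \<Rightarrow> 'w \<Rightarrow> 's" and I :: "'i set" +
  fixes N :: "'a::euclidean_space \<Rightarrow> real" and G :: "'a \<Rightarrow> 's \<Rightarrow> 'a" and \<sigma> :: real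
  assumes is_norm: "is_norm N"
    and G_measurable: "(\<lambda>(y, s). G y s) \<in> borel_measurable (borel \<Otimes>\<^sub>M P)"
    and G_integrable: "\<And>y. integrable P (G y)"
    and variance: "\<And>y. (\<integral>\<^sup>+s. ennreal ((dual_norm N (G y s - (LINT s|P. G y s)))\<^sup>2) \<partial>P) \<le> ennreal (\<sigma>\<^sup>2)"
begin

definition noise :: "'a \<Rightarrow> 's \<Rightarrow> 'a" where
  "noise y s = G y s - (LINT s|P. G y s)"

lemma noise_measurable: "(\<lambda>(y, s). noise y s) \<in> borel_measurable (borel \<Otimes>\<^sub>M P)"
proof -
  have "(\<lambda>y. LINT s|P. G y s) \<in> borel_measurable borel"
    using G_measurable by (rule P.borel_measurable_lebesgue_integral)
  then show ?thesis using G_measurable unfolding noise_def by measurable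
qed

lemma noise_measurable' [measurable (raw)]:
  "v \<in> borel_measurable Q \<Longrightarrow> h \<in> measurable Q P \<Longrightarrow> (\<lambda>w. noise (v w) (h w)) \<in> borel_measurable Q"
  using measurable_compose[OF measurable_Pair noise_measurable] by simp

lemma noise_mean_zero: "integrable P (noise y)" "(LINT s|P. noise y s) = 0"
  using G_integrable by (auto simp: noise_def[abs_def] P.prob_space)

context
  fixes J j and v :: "'w \<Rightarrow> 'a"
  assumes J: "J \<subseteq> I" "j \<in> I - J" and v: "v \<in> borel_measurable (past J)"
begin

lemma past_noise_measurable: "(\<lambda>w. noise (v w) (X j w)) \<in> borel_measurable M"
  using measurable_past_imp[OF J(1) v] sample_measurable J by (intro noise_measurable') auto

text \<open>Integrate out the fresh sample first: the variance bound is uniform in the query point.\<close>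
lemma past_noise_square:
  "integrable M (\<lambda>w. (dual_norm N (noise (v w) (X j w)))\<^sup>2)"
  "(LINT w|M. (dual_norm N (noise (v w) (X j w)))\<^sup>2) \<le> \<sigma>\<^sup>2"
proof -
  note [measurable] = past_noise_measurable borel_measurable_dual_norm[OF is_norm]
  have "(\<integral>\<^sup>+w. ennreal ((dual_norm N (noise (v w) (X j w)))\<^sup>2) \<partial>M)
      = (\<integral>\<^sup>+w. (\<integral>\<^sup>+s. ennreal ((dual_norm N (noise (v w) s))\<^sup>2) \<partial>P) \<partial>M)"
    using nn_integral_past_sample[OF J v, of "\<lambda>(y, s). ennreal ((dual_norm N (noise y s))\<^sup>2)"]
    by (simp add: case_prod_beta')
  also have "\<dots> \<le> (\<integral>\<^sup>+w. ennreal (\<sigma>\<^sup>2) \<partial>M)"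
    using variance by (intro nn_integral_mono) (simp add: noise_def)
  finally have le: "(\<integral>\<^sup>+w. ennreal ((dual_norm N (noise (v w) (X j w)))\<^sup>2) \<partial>M) \<le> ennreal (\<sigma>\<^sup>2)"
    by (simp add: emeasure_space_1)
  then show int: "integrable M (\<lambda>w. (dual_norm N (noise (v w) (X j w)))\<^sup>2)"
    by (intro integrableI_bounded) (auto intro: le_less_trans)
  from le show "(LINT w|M. (dual_norm N (noise (v w) (X j w)))\<^sup>2) \<le> \<sigma>\<^sup>2"
    by (subst (asm) nn_integral_eq_integral[OF int]) auto
qed

lemma past_noise_integrable: "integrable M (\<lambda>w. noise (v w) (X j w))"
proof -
  note [measurable] = past_noise_measurable
  obtain C where C: "0 < C" "\<And>y. norm y \<le> C * dual_norm N y"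
    using norm_le_dual_norm[OF is_norm] by blast
  have le: "norm y \<le> C * (1 + (dual_norm N y)\<^sup>2)" for y
  proof -
    have "dual_norm N y \<le> 1 + (dual_norm N y)\<^sup>2"
      using sum_squares_bound[of 1 "dual_norm N y"] dual_norm_nonneg[OF is_norm, of y] by simp
    then have "C * dual_norm N y \<le> C * (1 + (dual_norm N y)\<^sup>2)" using C by simp
    with C(2)[of y] show ?thesis by linarith
  qed
  show ?thesis
  proof (rule Bochner_Integration.integrable_bound)
    show "integrable M (\<lambda>w. C * (1 + (dual_norm N (noise (v w) (X j w)))\<^sup>2))"
      using past_noise_square(1) by simp
  qed (use le C in \<open>auto intro!: AE_I2 order_trans[OF le]\<close>)
qed

text \<open>The martingale property: with \<open>A\<close> and the query point held fixed, the fresh noise averages to zero.\<close>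
lemma past_noise_orthogonal:
  assumes A: "A \<in> borel_measurable (past J)" and bound: "\<And>w. norm (A w) \<le> B"
  shows "integrable M (\<lambda>w. A w \<bullet> noise (v w) (X j w))"
    and "(LINT w|M. A w \<bullet> noise (v w) (X j w)) = 0"
proof -
  note [measurable] = past_noise_measurable measurable_past_imp[OF J(1) A]
  show int: "integrable M (\<lambda>w. A w \<bullet> noise (v w) (X j w))"
  proof (rule Bochner_Integration.integrable_bound)
    show "integrable M (\<lambda>w. B * norm (noise (v w) (X j w)))"
      using past_noise_integrable by simp
    have "\<bar>A w \<bullet> y\<bar> \<le> \<bar>B * norm y\<bar>" for w y
      using Cauchy_Schwarz_ineq2[of "A w" y] mult_right_mono[OF bound[of w], of "norm y"] by simp
    then show "AE w in M. norm (A w \<bullet> noise (v w) (X j w)) \<le> norm (B * norm (noise (v w) (X j w)))"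
      by simp
  qed measurable
  have "(\<lambda>w. (A w, v w)) \<in> measurable (past J) (borel \<Otimes>\<^sub>M borel)"
    using A v by measurable
  from integral_past_sample[OF J this, of "\<lambda>((a, y), s). a \<bullet> noise y s"] int
  have "(LINT w|M. A w \<bullet> noise (v w) (X j w)) = (LINT w|M. LINT s|P. A w \<bullet> noise (v w) s)"
    by (simp add: case_prod_beta')
  also have "\<dots> = 0" using noise_mean_zero by simp
  finally show "(LINT w|M. A w \<bullet> noise (v w) (X j w)) = 0" .
qed

end

end

section \<open>The expected cost of mini-batch noise\<close>

locale mirror_descent_sampling =
  compact_mirror_map N K \<omega> g\<omega> + stochastic_gradient M P X I N G \<sigma>
  for N :: "'a::euclidean_space \<Rightarrow> real" and K :: "'a set"
    and \<omega> :: "'a \<Rightarrow> real" and g\<omega> :: "'a \<Rightarrow> 'a"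
    and M :: "'w measure" and P :: "'s measure" and X :: "'i \<Rightarrow> 'w \<Rightarrow> 's" and I :: "'i set"
    and G :: "'a \<Rightarrow> 's \<Rightarrow> 'a" and \<sigma> :: real
begin

lemma integrable_conjugate:
  assumes "integrable M Q" shows "integrable M (\<lambda>w. conjugate (Q w))"
proof -
  obtain r s where rs: "0 \<le> r" "\<And>p. \<bar>conjugate p\<bar> \<le> r * norm p + s"
    using conjugate_bounds by blast
  show ?thesis
  proof (rule Bochner_Integration.integrable_bound)
    show "integrable M (\<lambda>w. r * norm (Q w) + s)" using assms by simp
    show "(\<lambda>w. conjugate (Q w)) \<in> borel_measurable M"
      using assms by (intro borel_measurable_continuous_on[OF continuous_on_conjugate]) auto
    show "AE w in M. norm (conjugate (Q w)) \<le> norm (r * norm (Q w) + s)"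
      using rs(2) by (auto intro!: AE_I2 order_trans[OF _ abs_ge_self])
  qed
qed

lemma borel_measurable_gradient:
  assumes u: "u \<in> borel_measurable Q" and K: "\<And>w. u w \<in> K"
  shows "(\<lambda>w. g\<omega> (u w)) \<in> borel_measurable Q"
proof -
  have "(\<lambda>x. indicator K x *\<^sub>R g\<omega> x) \<in> borel_measurable borel"
    using compact_K by (intro borel_measurable_continuous_on_indicator continuous_gradient)
      (simp add: borel_closed compact_imp_closed)
  from measurable_compose[OF u this] show ?thesis using K by simp
qed

text \<open>Interpolate from the exact gradient to the averaged one by adding one sample at a time to the
  argument of the conjugate. At each addition the first-order term vanishes in mean, because the
  mirror point before it depends on the past and on earlier samples of the batch only. The
  second-order terms are proportional to \<open>1 / b\<^sup>2\<close> and there are \<open>b\<close> of them.\<close>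
lemma minibatch_noise:
  assumes J: "J \<subseteq> I" and js: "inj_on js {1..b}" "js ` {1..b} \<subseteq> I - J" and b: "1 \<le> (b::nat)"
    and u: "u \<in> borel_measurable (past J)" "\<And>w. u w \<in> K"
    and v: "v \<in> borel_measurable (past J)" and \<alpha>: "0 < \<alpha>"
  defines "e \<equiv> \<lambda>w. (1 / real b) *\<^sub>R (\<Sum>i=1..b. noise (v w) (X (js i) w))"
  shows "integrable M (\<lambda>w. \<alpha> * (conjugate (g\<omega> (u w) - e w /\<^sub>R \<alpha>) - conjugate (g\<omega> (u w))))"
    and "(LINT w|M. \<alpha> * (conjugate (g\<omega> (u w) - e w /\<^sub>R \<alpha>) - conjugate (g\<omega> (u w)))) \<le> \<sigma>\<^sup>2 / (2 * \<alpha> * real b)"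
proof -
  \<comment> \<open>the weight of one sample in the dual point \<open>g\<omega> (u w) - e w /\<^sub>R \<alpha>\<close>\<close>
  define \<beta> where "\<beta> = - (1 / (\<alpha> * real b))"
  define s where "s i w = noise (v w) (X (js i) w)" for i w
  define Q where "Q n w = g\<omega> (u w) + \<beta> *\<^sub>R (\<Sum>i=1..n. s i w)" for n w
  \<comment> \<open>the samples known once \<open>n\<close> samples of the batch have been added\<close>
  define H where "H n = J \<union> js ` {1..n}" for n
  have H_sub: "H n \<subseteq> I" if "n \<le> b" for n
  proof -
    have "js ` {1..n} \<subseteq> js ` {1..b}" using that by (intro image_mono) auto
    with J js show ?thesis unfolding H_def by blast
  qed
  have H: "H n \<subseteq> I" "js (Suc n) \<in> I - H n" if "n < b" for n
  proof -
    have "js (Suc n) \<notin> js ` {1..n}"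
      using inj_on_image_mem_iff[OF js(1), of "Suc n" "{1..n}"] that by auto
    moreover have "js (Suc n) \<in> I - J" by (rule subsetD[OF js(2)]) (use that in auto)
    ultimately show "js (Suc n) \<in> I - H n" by (auto simp: H_def)
  qed (use H_sub that in auto)
  have s_meas: "s i \<in> borel_measurable (past (H n))" if "i \<in> {1..n}" "n \<le> b" for i n
  proof -
    have "H n \<subseteq> I" using H_sub that by simp
    moreover have "js i \<in> H n" using that by (auto simp: H_def)
    ultimately have "X (js i) \<in> measurable (past (H n)) P" "v \<in> borel_measurable (past (H n))"
      by (auto intro: sample_measurable_past measurable_past_mono[OF _ _ v] simp: H_def)
    then show ?thesis unfolding s_def by measurable
  qed
  have Q_meas: "Q n \<in> borel_measurable (past (H n))" if "n \<le> b" for n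
  proof -
    have "H n \<subseteq> I" using H_sub that by simp
    then have "(\<lambda>w. g\<omega> (u w)) \<in> borel_measurable (past (H n))"
      by (intro borel_measurable_gradient u measurable_past_mono[OF _ _ u(1)]) (auto simp: H_def)
    then show ?thesis unfolding Q_def using s_meas that
      by (auto intro!: borel_measurable_add borel_measurable_scaleR borel_measurable_sum)
  qed
  have s_int: "integrable M (s (Suc n))" if "n < b" for n
    using H[OF that] unfolding s_def
    by (intro past_noise_integrable[where J="H n"] measurable_past_mono[OF _ _ v]) (auto simp: H_def)
  obtain B where B: "\<And>x. x \<in> g\<omega> ` K \<Longrightarrow> norm x \<le> B"
    using compact_imp_bounded[OF compact_continuous_image[OF continuous_gradient compact_K]]
    by (auto simp: bounded_iff)
  have gu_int: "integrable M (\<lambda>w. g\<omega> (u w))"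
  proof (rule integrable_const_bound)
    show "(\<lambda>w. g\<omega> (u w)) \<in> borel_measurable M"
      by (intro borel_measurable_gradient u measurable_past_imp[OF J u(1)])
  qed (use B u in auto)
  have Q_int: "integrable M (Q n)" if "n \<le> b" for n
  proof -
    have "integrable M (s i)" if "i \<in> {1..n}" for i
      using s_int[of "i - 1"] that \<open>n \<le> b\<close> by (cases i) auto
    with gu_int show ?thesis unfolding Q_def
      by (intro Bochner_Integration.integrable_add integrable_scaleR_right
          Bochner_Integration.integrable_sum) auto
  qed
  have step: "(LINT w|M. conjugate (Q (Suc n) w)) \<le> (LINT w|M. conjugate (Q n w)) + \<beta>\<^sup>2 * \<sigma>\<^sup>2 / 2"
    if "n < b" for n
  proof -
    have v': "v \<in> borel_measurable (past (H n))"
      using H[OF that] by (intro measurable_past_mono[OF _ _ v]) (auto simp: H_def)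
    note sq = past_noise_square[OF H[OF that] v', folded s_def]
    obtain r where r: "\<And>x. x \<in> K \<Longrightarrow> norm x \<le> r"
      using compact_imp_bounded[OF compact_K] by (auto simp: bounded_iff)
    have "(\<lambda>w. mirror (Q n w)) \<in> borel_measurable (past (H n))"
      using that by (intro borel_measurable_continuous_on[OF continuous_on_mirror] Q_meas) auto
    note orth = past_noise_orthogonal[OF H[OF that] v' this, of r, OF r[OF mirror_in_K], folded s_def]
    have "conjugate (Q (Suc n) w) \<le> conjugate (Q n w) + \<beta> * (mirror (Q n w) \<bullet> s (Suc n) w)
        + \<beta>\<^sup>2 / 2 * (dual_norm N (s (Suc n) w))\<^sup>2" for w
    proof -
      have "Q (Suc n) w = Q n w + \<beta> *\<^sub>R s (Suc n) w" by (simp add: Q_def algebra_simps)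
      then have "conjugate (Q (Suc n) w) \<le> conjugate (Q n w) + (\<beta> *\<^sub>R s (Suc n) w) \<bullet> mirror (Q n w)
          + (dual_norm N (\<beta> *\<^sub>R s (Suc n) w))\<^sup>2 / 2"
        by (simp only: conjugate_smooth)
      moreover have "(dual_norm N (\<beta> *\<^sub>R s (Suc n) w))\<^sup>2 \<le> (\<bar>\<beta>\<bar> * dual_norm N (s (Suc n) w))\<^sup>2"
        by (intro power_mono dual_norm_scale[OF norm] dual_norm_nonneg[OF norm])
      ultimately show ?thesis by (simp add: inner_commute power_mult_distrib)
    qed
    then have "(LINT w|M. conjugate (Q (Suc n) w)) \<le> (LINT w|M. conjugate (Q n w)
        + \<beta> * (mirror (Q n w) \<bullet> s (Suc n) w) + \<beta>\<^sup>2 / 2 * (dual_norm N (s (Suc n) w))\<^sup>2)"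
      using that sq orth by (intro integral_mono Bochner_Integration.integrable_add integrable_conjugate Q_int) auto
    also have "\<dots> = (LINT w|M. conjugate (Q n w)) + \<beta>\<^sup>2 / 2 * (LINT w|M. (dual_norm N (s (Suc n) w))\<^sup>2)"
      using that sq orth integrable_conjugate[OF Q_int, of n] by simp
    also have "\<dots> \<le> (LINT w|M. conjugate (Q n w)) + \<beta>\<^sup>2 / 2 * \<sigma>\<^sup>2"
      using sq by (intro add_left_mono mult_left_mono) auto
    finally show ?thesis by simp
  qed
  have "(LINT w|M. conjugate (Q n w)) \<le> (LINT w|M. conjugate (Q 0 w)) + real n * (\<beta>\<^sup>2 * \<sigma>\<^sup>2 / 2)"
    if "n \<le> b" for n
    using that
  proof (induction n)
    case (Suc n)
    have "real (Suc n) * (\<beta>\<^sup>2 * \<sigma>\<^sup>2 / 2) = real n * (\<beta>\<^sup>2 * \<sigma>\<^sup>2 / 2) + \<beta>\<^sup>2 * \<sigma>\<^sup>2 / 2"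
      by (simp only: of_nat_Suc distrib_right)
    moreover have "n < b" "n \<le> b" using Suc.prems by auto
    ultimately show ?case using step[of n] Suc.IH by linarith
  qed simp
  from this[of b] have "(LINT w|M. conjugate (Q b w)) - (LINT w|M. conjugate (Q 0 w)) \<le> real b * (\<beta>\<^sup>2 * \<sigma>\<^sup>2 / 2)"
    by simp
  then have "\<alpha> * ((LINT w|M. conjugate (Q b w)) - (LINT w|M. conjugate (Q 0 w))) \<le> \<alpha> * (real b * (\<beta>\<^sup>2 * \<sigma>\<^sup>2 / 2))"
    using \<alpha> by (intro mult_left_mono) auto
  also have "\<dots> = \<sigma>\<^sup>2 / (2 * \<alpha> * real b)"
    using \<alpha> b by (simp add: \<beta>_def power2_eq_square field_simps)
  finally have final: "\<alpha> * ((LINT w|M. conjugate (Q b w)) - (LINT w|M. conjugate (Q 0 w))) \<le> \<sigma>\<^sup>2 / (2 * \<alpha> * real b)" .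
  have "g\<omega> (u w) - e w /\<^sub>R \<alpha> = Q b w" "g\<omega> (u w) = Q 0 w" for w
    using \<alpha> b by (auto simp: Q_def e_def s_def \<beta>_def field_simps)
  then have eq: "\<alpha> * (conjugate (g\<omega> (u w) - e w /\<^sub>R \<alpha>) - conjugate (g\<omega> (u w)))
      = \<alpha> * (conjugate (Q b w) - conjugate (Q 0 w))" for w by simp
  note int = integrable_conjugate[OF Q_int[of b]] integrable_conjugate[OF Q_int[of 0]]
  show "integrable M (\<lambda>w. \<alpha> * (conjugate (g\<omega> (u w) - e w /\<^sub>R \<alpha>) - conjugate (g\<omega> (u w))))"
    unfolding eq using int by simp
  show "(LINT w|M. \<alpha> * (conjugate (g\<omega> (u w) - e w /\<^sub>R \<alpha>) - conjugate (g\<omega> (u w)))) \<le> \<sigma>\<^sup>2 / (2 * \<alpha> * real b)"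
    unfolding eq using int final by simp
qed

end

section \<open>Sums over delays and step sizes\<close>

text \<open>Each displacement since the delayed read is a sum of at most \<open>\<tau> + 1\<close> steps, which costs one factor
  \<open>\<tau> + 1\<close> by Cauchy-Schwarz. A given step occurs in at most \<open>\<tau> + 1\<close> of these sums, which costs the other.\<close>
lemma delayed_displacement_sum:
  fixes x :: "nat \<Rightarrow> 'a::real_vector"
  assumes N: "is_norm N" and d: "\<And>k. d k \<le> k" "\<And>k. k - d k \<le> \<tau>"
  shows "(\<Sum>k<T. (N (x (Suc k) - x (d k)))\<^sup>2) \<le> (real \<tau> + 1)\<^sup>2 * (\<Sum>k<T. (N (x (Suc k) - x k))\<^sup>2)"
proof -
  define a where "a j = N (x (Suc j) - x j)" for j
  have path: "N (x (n + m) - x n) \<le> (\<Sum>j=n..<n+m. a j)" for n m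
  proof (induction m)
    case 0
    then show ?case by (simp add: is_norm_zero[OF N])
  next
    case (Suc m)
    have "N (x (n + Suc m) - x n) = N ((x (Suc (n + m)) - x (n + m)) + (x (n + m) - x n))" by simp
    also have "\<dots> \<le> a (n + m) + N (x (n + m) - x n)"
      unfolding a_def using N unfolding is_norm_def by blast
    finally show ?case using Suc by simp
  qed
  have step: "(N (x (Suc k) - x (d k)))\<^sup>2 \<le> (real \<tau> + 1) * (\<Sum>j\<in>{d k..k}. (a j)\<^sup>2)" for k
  proof -
    have "N (x (Suc k) - x (d k)) \<le> (\<Sum>j\<in>{d k..k}. a j)"
      using path[of "d k" "Suc k - d k"] d(1)[of k] by (simp add: atLeastLessThanSuc_atLeastAtMost)
    then have "(N (x (Suc k) - x (d k)))\<^sup>2 \<le> (\<Sum>j\<in>{d k..k}. a j)\<^sup>2"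
      using N by (intro power_mono) (auto simp: is_norm_def)
    also have "\<dots> \<le> (\<Sum>j\<in>{d k..k}. (a j)\<^sup>2) * real (card {d k..k})"
      by (rule sum_squared_le_sum_of_squares)
    also have "\<dots> \<le> (\<Sum>j\<in>{d k..k}. (a j)\<^sup>2) * (real \<tau> + 1)"
      using d[of k] by (intro mult_left_mono sum_nonneg) auto
    finally show ?thesis by (simp add: mult.commute)
  qed
  have "(\<Sum>k<T. \<Sum>j\<in>{d k..k}. (a j)\<^sup>2) = (\<Sum>k<T. \<Sum>j | j < T \<and> d k \<le> j \<and> j \<le> k. (a j)\<^sup>2)"
    by (intro sum.cong refl) auto
  also have "\<dots> = (\<Sum>j<T. \<Sum>k | k < T \<and> d k \<le> j \<and> j \<le> k. (a j)\<^sup>2)"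
    using sum.swap_restrict[of "{..<T}" "{..<T}" "\<lambda>k j. (a j)\<^sup>2" "\<lambda>k j. d k \<le> j \<and> j \<le> k"] by simp
  also have "\<dots> \<le> (\<Sum>j<T. (real \<tau> + 1) * (a j)\<^sup>2)"
  proof (rule sum_mono)
    fix j
    \<comment> \<open>the updates whose delay window contains \<open>j\<close>\<close>
    have "{k. k < T \<and> d k \<le> j \<and> j \<le> k} \<subseteq> {j..j + \<tau>}"
    proof safe
      fix k assume "d k \<le> j" "j \<le> k"
      with d(2)[of k] show "k \<in> {j..j + \<tau>}" by simp
    qed
    then have "card {k. k < T \<and> d k \<le> j \<and> j \<le> k} \<le> \<tau> + 1"
      using card_mono[of "{j..j + \<tau>}"] by simp
    then have "real (card {k. k < T \<and> d k \<le> j \<and> j \<le> k}) \<le> real \<tau> + 1" by linarith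
    then show "(\<Sum>k | k < T \<and> d k \<le> j \<and> j \<le> k. (a j)\<^sup>2) \<le> (real \<tau> + 1) * (a j)\<^sup>2"
      by (simp add: mult_right_mono)
  qed
  finally have swap: "(\<Sum>k<T. \<Sum>j\<in>{d k..k}. (a j)\<^sup>2) \<le> (real \<tau> + 1) * (\<Sum>j<T. (a j)\<^sup>2)"
    by (simp add: sum_distrib_left)
  have "(\<Sum>k<T. (N (x (Suc k) - x (d k)))\<^sup>2) \<le> (real \<tau> + 1) * (\<Sum>k<T. \<Sum>j\<in>{d k..k}. (a j)\<^sup>2)"
    using step by (auto simp: sum_distrib_left intro!: sum_mono)
  also have "\<dots> \<le> (real \<tau> + 1) * ((real \<tau> + 1) * (\<Sum>j<T. (a j)\<^sup>2))"
    using swap by (intro mult_left_mono) auto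
  finally show ?thesis by (simp add: a_def power2_eq_square mult.assoc)
qed

text \<open>Abel summation; the induction carries the stronger bound \<open>c n * (B - D (Suc n))\<close>.\<close>
lemma weighted_telescope:
  fixes c D :: "nat \<Rightarrow> real"
  assumes D: "\<And>k. 0 \<le> D k" "\<And>k. D k \<le> B" and c: "0 \<le> c 0" "\<And>k. c k \<le> c (Suc k)"
  shows "(\<Sum>k<Suc n. c k * (D k - D (Suc k))) \<le> c n * B"
proof -
  have "(\<Sum>k<Suc n. c k * (D k - D (Suc k))) \<le> c n * (B - D (Suc n))"
  proof (induction n)
    case 0
    then show ?case using D(2)[of 0] c(1) by (simp add: mult_left_mono)
  next
    case (Suc n)
    have "0 \<le> (c (Suc n) - c n) * (B - D (Suc n))" using c(2)[of n] D(2)[of "Suc n"] by simp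
    with Suc show ?case by (simp add: algebra_simps)
  qed
  moreover have "0 \<le> c n" using c by (induction n) (auto intro: order_trans)
  then have "0 \<le> c n * D (Suc n)" using D(1) by simp
  ultimately show ?thesis by (simp add: algebra_simps)
qed

lemma sum_inverse_sqrt_le: "(\<Sum>k<T. 1 / sqrt (real (k + 1))) \<le> 2 * sqrt (real T)"
proof (induction T)
  case (Suc n)
  define p q where "p = sqrt (real n)" and "q = sqrt (real n + 1)"
  have pq: "0 \<le> p" "0 < q" "q * q = p * p + 1" by (auto simp: p_def q_def)
  have "2 * (p * q) \<le> p * p + q * q" using sum_squares_bound[of p q] by (simp add: power2_eq_square)
  then have "1 / q \<le> 2 * q - 2 * p" using pq by (simp add: field_simps)
  with Suc show ?case by (simp add: p_def q_def add.commute)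
qed simp

section \<open>Smooth convex functions\<close>

lemma has_derivative_along_line:
  assumes "\<And>y. GDERIV f y :> g y"
  shows "((\<lambda>t. f (y + t *\<^sub>R h)) has_real_derivative g (y + t *\<^sub>R h) \<bullet> h) (at t)"
proof -
  have "((\<lambda>t. y + t *\<^sub>R h) has_derivative (\<lambda>s. s *\<^sub>R h)) (at t)"
    by (auto intro!: derivative_eq_intros)
  from has_derivative_compose[OF this assms[unfolded gderiv_def]]
  show ?thesis by (simp add: has_field_derivative_def inner_commute mult.commute[of _ "_ \<bullet> _"])
qed

lemma convex_above_tangent:
  assumes f: "convex_on UNIV f" and g: "\<And>y. GDERIV f y :> g y"
  shows "f y + g y \<bullet> (z - y) \<le> f z"
proof -
  let ?l = "\<lambda>t::real. f (y + t *\<^sub>R (z - y))"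
  have "convex_on UNIV ?l"
  proof (rule convex_onI)
    fix t s r :: real
    assume "0 < t" "t < 1"
    have "y + ((1 - t) *\<^sub>R s + t *\<^sub>R r) *\<^sub>R (z - y)
        = (1 - t) *\<^sub>R (y + s *\<^sub>R (z - y)) + t *\<^sub>R (y + r *\<^sub>R (z - y))"
      by (simp add: algebra_simps)
    then show "?l ((1 - t) *\<^sub>R s + t *\<^sub>R r) \<le> (1 - t) * ?l s + t * ?l r"
      using convex_onD[OF f, of t] \<open>0 < t\<close> \<open>t < 1\<close> by simp
  qed simp
  from convex_on_imp_above_tangent[OF this, of 0 1 "g y \<bullet> (z - y)"]
    has_derivative_along_line[OF g, of y "z - y" 0]
  show ?thesis by simp
qed

lemma smooth_descent:
  assumes N: "is_norm N" and g: "\<And>y. GDERIV f y :> g y"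
    and lip: "\<And>y z h. h \<bullet> (g z - g y) \<le> L * N h * N (z - y)"
  shows "f z \<le> f y + g y \<bullet> (z - y) + L / 2 * (N (z - y))\<^sup>2"
proof -
  let ?h = "z - y"
  let ?l = "\<lambda>t. f (y + t *\<^sub>R ?h) - t * (g y \<bullet> ?h) - L / 2 * (N ?h)\<^sup>2 * t\<^sup>2"
  have "?l 1 \<le> ?l 0"
  proof (rule DERIV_nonpos_imp_nonincreasing[where f = ?l])
    fix t :: real assume t: "0 \<le> t"
    have "(?l has_real_derivative g (y + t *\<^sub>R ?h) \<bullet> ?h - g y \<bullet> ?h - L * (N ?h)\<^sup>2 * t) (at t)"
      by (auto intro!: derivative_eq_intros has_derivative_along_line[OF g])
    moreover have "?h \<bullet> (g (y + t *\<^sub>R ?h) - g y) \<le> L * N ?h * N (t *\<^sub>R ?h)"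
      using lip[of ?h "y + t *\<^sub>R ?h" y] by simp
    moreover have "N (t *\<^sub>R ?h) = t * N ?h" using N t by (simp add: is_norm_def)
    ultimately show "\<exists>D. (?l has_real_derivative D) (at t) \<and> D \<le> 0"
      by (intro exI conjI) (auto simp: inner_commute inner_diff_right power2_eq_square mult_ac)
  qed simp
  then show ?thesis by simp
qed

section \<open>Regret of asynchronous mirror descent along one sample path\<close>

context compact_mirror_map
begin

text \<open>The step depends on the past only through one dual point, and has the form to which
  \<open>three_point_inequality\<close> and \<open>borel_argmin_selector\<close> apply.\<close>
lemma prox_argmin_iff:
  assumes \<gamma>: "0 < \<gamma>"
  shows "is_arg_min (\<lambda>z. q \<bullet> z + \<psi> z + 1 / \<gamma> * bregman \<omega> g\<omega> u z) (\<lambda>z. z \<in> K) y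
    \<longleftrightarrow> is_arg_min (\<lambda>z. \<gamma> * \<psi> z - (g\<omega> u - \<gamma> *\<^sub>R q) \<bullet> z + \<omega> z) (\<lambda>z. z \<in> K) y"
proof -
  have "\<gamma> * \<psi> z - (g\<omega> u - \<gamma> *\<^sub>R q) \<bullet> z + \<omega> z
      = \<gamma> * (q \<bullet> z + \<psi> z + 1 / \<gamma> * bregman \<omega> g\<omega> u z) + (\<omega> u - g\<omega> u \<bullet> u)" for z
    using \<gamma> by (simp add: bregman_def algebra_simps inner_diff_left inner_diff_right)
  then show ?thesis using \<gamma> by (simp add: is_arg_min_linorder)
qed

context
  fixes f \<psi> g z and L :: real
  assumes f: "convex_on UNIV f" and g: "\<And>y. GDERIV f y :> g y"
    and lip: "\<And>y z h. h \<bullet> (g z - g y) \<le> L * N h * N (z - y)"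
    and \<psi>: "convex_on K \<psi>" and z: "z \<in> K"
begin

text \<open>The descent inequality goes from \<open>v\<close> to \<open>y\<close> and the tangent inequality from \<open>v\<close> to \<open>z\<close>, so that the
  point \<open>v\<close> where the gradient was evaluated may differ from the point \<open>u\<close> of the proximal term.\<close>
lemma prox_step_progress:
  assumes \<gamma>: "0 < \<gamma>"
    and y: "is_arg_min (\<lambda>z. q \<bullet> z + \<psi> z + 1 / \<gamma> * bregman \<omega> g\<omega> u z) (\<lambda>z. z \<in> K) y"
  shows "f y + \<psi> y - (f z + \<psi> z) \<le> 1 / \<gamma> * (bregman \<omega> g\<omega> u z - bregman \<omega> g\<omega> y z)
    - 1 / \<gamma> * bregman \<omega> g\<omega> u y - (q - g v) \<bullet> (y - z) + L / 2 * (N (y - v))\<^sup>2"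
proof -
  have cvx: "convex_on K (\<lambda>z. \<gamma> * \<psi> z + (- (g\<omega> u - \<gamma> *\<^sub>R q)) \<bullet> z)"
    using \<gamma> \<psi> by (intro convex_on_add convex_on_cmul convex_on_inner[OF convex_K]) auto
  have "is_arg_min (\<lambda>z. (\<gamma> * \<psi> z + (- (g\<omega> u - \<gamma> *\<^sub>R q)) \<bullet> z) + \<omega> z) (\<lambda>z. z \<in> K) y"
    using y unfolding prox_argmin_iff[OF \<gamma>] by (simp add: is_arg_min_linorder inner_diff_left algebra_simps)
  from three_point_inequality[OF cvx this z]
  have "\<gamma> * (\<psi> y - \<psi> z + q \<bullet> (y - z)) \<le> bregman \<omega> g\<omega> u z - bregman \<omega> g\<omega> y z - bregman \<omega> g\<omega> u y"
    by (simp add: bregman_def algebra_simps inner_diff_left inner_diff_right)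
  then have "\<psi> y - \<psi> z + q \<bullet> (y - z)
      \<le> 1 / \<gamma> * (bregman \<omega> g\<omega> u z - bregman \<omega> g\<omega> y z - bregman \<omega> g\<omega> u y)"
    using \<gamma> by (simp add: field_simps)
  moreover have "f y \<le> f v + g v \<bullet> (y - v) + L / 2 * (N (y - v))\<^sup>2"
    by (rule smooth_descent[OF norm g lip])
  moreover have "f v + g v \<bullet> (z - v) \<le> f z" by (rule convex_above_tangent[OF f g])
  ultimately show ?thesis by (simp add: inner_diff_left inner_diff_right algebra_simps)
qed

text \<open>The share \<open>L * (\<tau> + 1)\<^sup>2\<close> of the inverse step size makes the Bregman step lengths outweigh the
  delay penalties. The share \<open>\<alpha> k\<close> enters the hypothesis on \<open>W\<close>, the cost of the gradient error.\<close>
lemma asynchronous_regret: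
  fixes x :: "nat \<Rightarrow> 'a" and \<gamma> \<alpha> W :: "nat \<Rightarrow> real"
  assumes L: "0 \<le> L" and d: "\<And>k. d k \<le> k" "\<And>k. k - d k \<le> \<tau>"
    and \<gamma>: "\<And>k. 0 < \<gamma> k" "\<And>k. inverse (\<gamma> k) = L * (real \<tau> + 1)\<^sup>2 + \<alpha> k"
    and \<alpha>: "0 \<le> \<alpha> 0" "\<And>k. \<alpha> k \<le> \<alpha> (Suc k)"
    and R: "\<And>y. y \<in> K \<Longrightarrow> bregman \<omega> g\<omega> y z \<le> B"
    and x: "\<And>k. x k \<in> K"
    and step: "\<And>k. is_arg_min (\<lambda>z. q k \<bullet> z + \<psi> z + 1 / \<gamma> k * bregman \<omega> g\<omega> (x k) z) (\<lambda>z. z \<in> K) (x (Suc k))"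
    and noise: "\<And>k. - ((q k - g (x (d k))) \<bullet> (x (Suc k) - z)) - \<alpha> k * bregman \<omega> g\<omega> (x k) (x (Suc k)) \<le> W k"
  shows "(\<Sum>k<Suc n. f (x (Suc k)) + \<psi> (x (Suc k)) - (f z + \<psi> z))
    \<le> (L * (real \<tau> + 1)\<^sup>2 + \<alpha> n) * B + (\<Sum>k<Suc n. W k)"
proof -
  define C where "C = L * (real \<tau> + 1)\<^sup>2"
  define D where "D k = bregman \<omega> g\<omega> (x k) (x (Suc k))" for k
  have C: "0 \<le> C" using L by (simp add: C_def)
  have each: "f (x (Suc k)) + \<psi> (x (Suc k)) - (f z + \<psi> z)
      \<le> (C + \<alpha> k) * (bregman \<omega> g\<omega> (x k) z - bregman \<omega> g\<omega> (x (Suc k)) z) + W k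
        + (L / 2 * (N (x (Suc k) - x (d k)))\<^sup>2 - C * D k)" for k
  proof -
    have "1 / \<gamma> k = C + \<alpha> k" using \<gamma>(2)[of k] by (simp add: C_def inverse_eq_divide)
    with prox_step_progress[OF \<gamma>(1) step, of k "x (d k)"] noise[of k] show ?thesis
      by (simp add: D_def algebra_simps)
  qed
  have "(\<Sum>k<Suc n. L / 2 * (N (x (Suc k) - x (d k)))\<^sup>2)
      \<le> L / 2 * ((real \<tau> + 1)\<^sup>2 * (\<Sum>k<Suc n. (N (x (Suc k) - x k))\<^sup>2))"
    unfolding sum_distrib_left[symmetric] using L
    by (intro mult_left_mono delayed_displacement_sum[OF norm d]) auto
  also have "\<dots> = (\<Sum>k<Suc n. C * ((N (x (Suc k) - x k))\<^sup>2 / 2))"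
    by (simp add: C_def sum_distrib_left[symmetric] sum_divide_distrib[symmetric] del: sum.lessThan_Suc)
  also have "\<dots> \<le> (\<Sum>k<Suc n. C * D k)"
    unfolding D_def using C x by (intro sum_mono mult_left_mono half_norm_le_bregman) auto
  finally have delay: "(\<Sum>k<Suc n. L / 2 * (N (x (Suc k) - x (d k)))\<^sup>2 - C * D k) \<le> 0"
    by (simp add: sum_subtractf del: sum.lessThan_Suc)
  have tele: "(\<Sum>k<Suc n. (C + \<alpha> k) * (bregman \<omega> g\<omega> (x k) z - bregman \<omega> g\<omega> (x (Suc k)) z)) \<le> (C + \<alpha> n) * B"
    using C \<alpha> x z R by (intro weighted_telescope bregman_nonneg) auto
  have "(\<Sum>k<Suc n. f (x (Suc k)) + \<psi> (x (Suc k)) - (f z + \<psi> z))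
      \<le> (\<Sum>k<Suc n. (C + \<alpha> k) * (bregman \<omega> g\<omega> (x k) z - bregman \<omega> g\<omega> (x (Suc k)) z) + W k
        + (L / 2 * (N (x (Suc k) - x (d k)))\<^sup>2 - C * D k))"
    by (intro sum_mono each)
  also have "\<dots> = (\<Sum>k<Suc n. (C + \<alpha> k) * (bregman \<omega> g\<omega> (x k) z - bregman \<omega> g\<omega> (x (Suc k)) z))
      + (\<Sum>k<Suc n. W k) + (\<Sum>k<Suc n. L / 2 * (N (x (Suc k) - x (d k)))\<^sup>2 - C * D k)"
    by (simp only: sum.distrib)
  also have "\<dots> \<le> (C + \<alpha> n) * B + (\<Sum>k<Suc n. W k)" using tele delay by linarith
  finally show ?thesis by (simp only: C_def)
qed

end

text \<open>The point \<open>y\<close>, which depends on the error \<open>e\<close>, disappears by Fenchel's inequality. What remains is a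
  function of \<open>u\<close>, \<open>e\<close> and \<open>z\<close> alone.\<close>
lemma noise_le_conjugate:
  assumes u: "u \<in> K" and y: "y \<in> K" and \<alpha>: "0 < \<alpha>"
  shows "- (e \<bullet> (y - z)) - \<alpha> * bregman \<omega> g\<omega> u y
    \<le> \<alpha> * (conjugate (g\<omega> u - e /\<^sub>R \<alpha>) - conjugate (g\<omega> u)) + e \<bullet> z"
proof -
  have "\<alpha> * ((g\<omega> u - e /\<^sub>R \<alpha>) \<bullet> y - \<omega> y - (g\<omega> u \<bullet> u - \<omega> u))
      \<le> \<alpha> * (conjugate (g\<omega> u - e /\<^sub>R \<alpha>) - conjugate (g\<omega> u))"
    using \<alpha> inner_minus_dgf_le_conjugate[OF y, of "g\<omega> u - e /\<^sub>R \<alpha>"] conjugate_gradient[OF u]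
    by (intro mult_left_mono) auto
  moreover have "\<alpha> * ((g\<omega> u - e /\<^sub>R \<alpha>) \<bullet> y - \<omega> y - (g\<omega> u \<bullet> u - \<omega> u))
      = - (e \<bullet> (y - z)) - \<alpha> * bregman \<omega> g\<omega> u y - e \<bullet> z"
    using \<alpha> by (simp add: bregman_def inner_diff_left inner_diff_right algebra_simps)
  ultimately show ?thesis by linarith
qed

end

section \<open>Expected regret of asynchronous mirror descent\<close>

text \<open>Sample \<open>(k, i)\<close> is the \<open>i\<close>-th sample of the batch of update \<open>k\<close>.\<close>
locale asynchronous_mirror_descent =
  mirror_descent_sampling N K \<omega> g\<omega> M P X "UNIV \<times> {1..b}" G \<sigma>
  for N :: "'a::euclidean_space \<Rightarrow> real" and K :: "'a set"
    and \<omega> :: "'a \<Rightarrow> real" and g\<omega> :: "'a \<Rightarrow> 'a"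
    and M :: "'w measure" and P :: "'s measure" and X :: "nat \<times> nat \<Rightarrow> 'w \<Rightarrow> 's" and b :: nat
    and G :: "'a \<Rightarrow> 's \<Rightarrow> 'a" and \<sigma> :: real +
  fixes \<psi> :: "'a \<Rightarrow> real" and \<gamma> :: "nat \<Rightarrow> real" and d :: "nat \<Rightarrow> nat"
    and x0 :: 'a and x :: "nat \<Rightarrow> 'w \<Rightarrow> 'a"
  assumes b_pos: "1 \<le> b" and \<psi>_convex: "convex_on K \<psi>" and \<gamma>_pos: "\<And>k. 0 < \<gamma> k"
    and d_le: "\<And>k. d k \<le> k"
    and x0: "x0 \<in> K" and x_init: "AE w in M. x 0 w = x0"
    and x_step: "\<And>k. AE w in M. is_arg_min
      (\<lambda>z. ((1 / real b) *\<^sub>R (\<Sum>i=1..b. G (x (d k) w) (X (k, i) w))) \<bullet> z + \<psi> z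
        + 1 / \<gamma> k * bregman \<omega> g\<omega> (x k w) z) (\<lambda>z. z \<in> K) (x (Suc k) w)"
begin

text \<open>The indices of the samples drawn before update \<open>k\<close>, on which \<open>x k\<close> may depend.\<close>
definition before :: "nat \<Rightarrow> (nat \<times> nat) set" where
  "before k = {..<k} \<times> {1..b}"

lemma before_subset: "before k \<subseteq> UNIV \<times> {1..b}" "j \<le> k \<Longrightarrow> before j \<subseteq> before k"
  by (auto simp: before_def)

text \<open>Null sets may prevent \<open>x k\<close> itself from being measurable with respect to the past, so the lemma
  provides a version of it. The version is forced to lie in \<open>K\<close> everywhere, because \<open>g\<omega>\<close> is under
  control only there.\<close>
lemma iterate_adapted:
  "\<exists>x'. x' \<in> borel_measurable (past (before k)) \<and> (\<forall>w. x' w \<in> K) \<and> (AE w in M. x k w = x' w)"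
proof (induction k rule: less_induct)
  case (less n)
  show ?case
  proof (cases n)
    case 0
    show ?thesis using x0 x_init 0 by (intro exI[of _ "\<lambda>_. x0"]) auto
  next
    case (Suc k)
    from less[of k] Suc obtain u where u: "u \<in> borel_measurable (past (before k))" "\<And>w. u w \<in> K"
      "AE w in M. x k w = u w" by auto
    from less[of "d k"] d_le[of k] Suc obtain v where v: "v \<in> borel_measurable (past (before (d k)))"
      "AE w in M. x (d k) w = v w" by (auto simp: less_Suc_eq_le)
    have "convex_on K (\<lambda>z. \<gamma> k * \<psi> z)"
      using \<psi>_convex \<gamma>_pos[of k] by (intro convex_on_cmul) auto
    then obtain T where T: "T \<in> borel_measurable borel"
      "\<And>p y. is_arg_min (\<lambda>z. \<gamma> k * \<psi> z - p \<bullet> z + \<omega> z) (\<lambda>z. z \<in> K) y \<Longrightarrow> T p = y"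
      using borel_argmin_selector by blast
    define q where "q w = (1 / real b) *\<^sub>R (\<Sum>i=1..b. G (v w) (X (k, i) w))" for w
    define y where "y w = T (g\<omega> (u w) - \<gamma> k *\<^sub>R q w)" for w
    have u_meas: "u \<in> borel_measurable (past (before n))"
      using Suc by (intro measurable_past_mono[OF _ _ u(1)] before_subset) auto
    have v_meas: "v \<in> borel_measurable (past (before n))"
      using Suc d_le[of k] by (intro measurable_past_mono[OF _ _ v(1)] before_subset) auto
    have "X (k, i) \<in> measurable (past (before n)) P" if "i \<in> {1..b}" for i
      using that Suc by (intro sample_measurable_past before_subset) (auto simp: before_def)
    then have "(\<lambda>w. G (v w) (X (k, i) w)) \<in> borel_measurable (past (before n))" if "i \<in> {1..b}" for i
      using measurable_compose[OF measurable_Pair[OF v_meas] G_measurable] that by simp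
    then have "q \<in> borel_measurable (past (before n))"
      unfolding q_def by (intro borel_measurable_scaleR borel_measurable_sum) auto
    then have "(\<lambda>w. g\<omega> (u w) - \<gamma> k *\<^sub>R q w) \<in> borel_measurable (past (before n))"
      by (intro borel_measurable_diff borel_measurable_scaleR borel_measurable_gradient u_meas u(2)) auto
    from measurable_compose[OF this T(1)] have y_meas: "y \<in> borel_measurable (past (before n))"
      unfolding y_def .
    have [measurable]: "K \<in> sets borel"
      using compact_K by (simp add: borel_closed compact_imp_closed)
    define x' where "x' w = (if y w \<in> K then y w else x0)" for w
    have "x' \<in> borel_measurable (past (before n))"
      unfolding x'_def using y_meas by measurable
    moreover have "AE w in M. x n w = x' w"
      using x_step[of k] u(3) v(2)
    proof eventually_elim
      case (elim w)
      have "is_arg_min (\<lambda>z. q w \<bullet> z + \<psi> z + 1 / \<gamma> k * bregman \<omega> g\<omega> (u w) z) (\<lambda>z. z \<in> K) (x (Suc k) w)"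
        using elim by (simp add: q_def)
      then have "y w = x (Suc k) w" and "x (Suc k) w \<in> K"
        unfolding prox_argmin_iff[OF \<gamma>_pos] y_def by (auto intro: T(2) simp: is_arg_min_linorder)
      then show "x n w = x' w" by (simp add: x'_def Suc)
    qed
    moreover have "\<forall>w. x' w \<in> K" using x0 by (simp add: x'_def)
    ultimately show ?thesis by blast
  qed
qed

lemma iterate_in_K: "AE w in M. \<forall>k. x k w \<in> K"
  unfolding AE_all_countable
proof
  fix k
  obtain x' where "\<And>w. x' w \<in> K" "AE w in M. x k w = x' w" using iterate_adapted[of k] by blast
  then show "AE w in M. x k w \<in> K" by auto
qed

definition error :: "nat \<Rightarrow> 'w \<Rightarrow> 'a" where
  "error k w = (1 / real b) *\<^sub>R (\<Sum>i=1..b. noise (x (d k) w) (X (k, i) w))"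

lemma error_eq:
  "error k w = (1 / real b) *\<^sub>R (\<Sum>i=1..b. G (x (d k) w) (X (k, i) w)) - (LINT s|P. G (x (d k) w) s)"
  using b_pos by (simp add: error_def noise_def sum_subtractf scaleR_diff_right sum_constant_scaleR)

text \<open>For \<open>\<alpha> > 0\<close> this is \<open>noise_le_conjugate\<close> followed by \<open>minibatch_noise\<close>; the remaining term \<open>e \<bullet> z\<close> has
  mean zero. The case \<open>\<alpha> = 0\<close> is degenerate: there the gradient is almost surely exact or the domain
  is a single point, and the error costs nothing.\<close>
lemma error_cost:
  assumes z: "z \<in> K" and \<alpha>: "0 \<le> \<alpha>" "\<alpha> = 0 \<Longrightarrow> \<sigma> = 0 \<or> K = {z}"
    and B: "0 \<le> B" "\<alpha> \<noteq> 0 \<Longrightarrow> \<sigma>\<^sup>2 / (2 * \<alpha> * real b) \<le> B"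
  shows "\<exists>W. integrable M W \<and> (LINT w|M. W w) \<le> B \<and>
    (AE w in M. - (error k w \<bullet> (x (Suc k) w - z)) - \<alpha> * bregman \<omega> g\<omega> (x k w) (x (Suc k) w) \<le> W w)"
proof -
  obtain u where u: "u \<in> borel_measurable (past (before k))" "\<And>w. u w \<in> K" "AE w in M. x k w = u w"
    using iterate_adapted[of k] by blast
  obtain v' where v': "v' \<in> borel_measurable (past (before (d k)))" "AE w in M. x (d k) w = v' w"
    using iterate_adapted[of "d k"] by blast
  have v: "v' \<in> borel_measurable (past (before k))"
    using d_le by (intro measurable_past_mono[OF _ _ v'(1)] before_subset)
  have fresh: "(k, i) \<in> UNIV \<times> {1..b} - before k" if "i \<in> {1..b}" for i
    using that by (auto simp: before_def)
  define e where "e w = (1 / real b) *\<^sub>R (\<Sum>i=1..b. noise (v' w) (X (k, i) w))" for w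
  have error: "AE w in M. error k w = e w"
    using v'(2) by eventually_elim (simp add: error_def e_def)
  consider "0 < \<alpha>" | "\<alpha> = 0" "\<sigma> = 0" | "\<alpha> = 0" "K = {z}" using \<alpha> by fastforce
  then show ?thesis
  proof cases
    case 1
    define W where "W w = \<alpha> * (conjugate (g\<omega> (u w) - e w /\<^sub>R \<alpha>) - conjugate (g\<omega> (u w))) + e w \<bullet> z" for w
    have "inj_on (Pair k) {1..b}" "Pair k ` {1..b} \<subseteq> UNIV \<times> {1..b} - before k"
      using fresh by (auto simp: inj_on_def)
    note conj = minibatch_noise[OF before_subset(1) this b_pos u(1,2) v 1, folded e_def]
    have "integrable M (\<lambda>w. z \<bullet> noise (v' w) (X (k, i) w))"
        "(LINT w|M. z \<bullet> noise (v' w) (X (k, i) w)) = 0" if "i \<in> {1..b}" for i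
      using past_noise_orthogonal[OF before_subset(1) fresh[OF that] v, of "\<lambda>_. z" "norm z"] by auto
    moreover have "e w \<bullet> z = (1 / real b) * (\<Sum>i=1..b. z \<bullet> noise (v' w) (X (k, i) w))" for w
      by (simp add: e_def inner_sum_right inner_commute)
    ultimately have ez: "integrable M (\<lambda>w. e w \<bullet> z)" "(LINT w|M. e w \<bullet> z) = 0"
      by (auto simp: Bochner_Integration.integral_sum intro!: Bochner_Integration.integrable_sum
          integrable_divide)
    have "AE w in M. - (error k w \<bullet> (x (Suc k) w - z)) - \<alpha> * bregman \<omega> g\<omega> (x k w) (x (Suc k) w) \<le> W w"
      using error u(3) iterate_in_K
    proof eventually_elim
      case (elim w)
      then have "x (Suc k) w \<in> K" by simp
      from noise_le_conjugate[OF u(2)[of w] this 1] elim show ?case by (simp add: W_def)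
    qed
    moreover have "(LINT w|M. W w) \<le> B"
      using conj ez B(2) 1 unfolding W_def by simp
    moreover have "integrable M W" using conj ez unfolding W_def by simp
    ultimately show ?thesis by blast
  next
    case 2
    obtain C where C: "\<And>y. norm y \<le> C * dual_norm N y" using norm_le_dual_norm[OF norm] by blast
    have "AE w in M. noise (v' w) (X (k, i) w) = 0" if "i \<in> {1..b}" for i
    proof -
      note sq = past_noise_square[OF before_subset(1) fresh[OF that] v]
      have "(LINT w|M. (dual_norm N (noise (v' w) (X (k, i) w)))\<^sup>2) = 0"
        using sq(2) 2 by (intro antisym integral_nonneg_AE) auto
      then have "AE w in M. (dual_norm N (noise (v' w) (X (k, i) w)))\<^sup>2 = 0"
        using integral_nonneg_eq_0_iff_AE[OF sq(1)] by simp
      then show ?thesis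
      proof eventually_elim
        case (elim w)
        with C[of "noise (v' w) (X (k, i) w)"] show ?case by simp
      qed
    qed
    then have "AE w in M. \<forall>i\<in>{1..b}. noise (v' w) (X (k, i) w) = 0"
      by (intro AE_ball_countable' ) auto
    with error have "AE w in M. error k w = 0"
      by eventually_elim (simp add: e_def)
    with 2 B(1) show ?thesis by (intro exI[of _ "\<lambda>_. 0"]) auto
  next
    case 3
    have "AE w in M. x (Suc k) w = z" using iterate_in_K 3(2) by auto
    with 3(1) B(1) show ?thesis by (intro exI[of _ "\<lambda>_. 0"]) auto
  qed
qed

text \<open>The regret is dominated by an integrable \<open>W\<close> instead of being integrated itself, since a convex
  \<open>\<psi>\<close> can fail to be measurable on the boundary of \<open>K\<close>.\<close>
theorem expected_regret:
  assumes f: "convex_on UNIV f" "\<And>y. GDERIV f y :> (LINT s|P. G y s)"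
    and lip: "\<And>y z h. h \<bullet> ((LINT s|P. G z s) - (LINT s|P. G y s)) \<le> L * N h * N (z - y)"
    and L: "0 \<le> L" and delay: "\<And>k. k - d k \<le> \<tau>"
    and \<gamma>_eq: "\<And>k. inverse (\<gamma> k) = L * (real \<tau> + 1)\<^sup>2 + \<alpha> k"
    and \<alpha>: "0 \<le> \<alpha> 0" "\<And>k. \<alpha> k \<le> \<alpha> (Suc k)" "\<And>k. \<alpha> k = 0 \<Longrightarrow> \<sigma> = 0 \<or> K = {z}"
    and B: "\<And>k. 0 \<le> B k" "\<And>k. \<alpha> k \<noteq> 0 \<Longrightarrow> \<sigma>\<^sup>2 / (2 * \<alpha> k * real b) \<le> B k"
    and z: "z \<in> K" and D: "\<And>y. y \<in> K \<Longrightarrow> bregman \<omega> g\<omega> y z \<le> D"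
  shows "\<exists>W. integrable M W
    \<and> (LINT w|M. W w) \<le> (L * (real \<tau> + 1)\<^sup>2 + \<alpha> n) * D + (\<Sum>k<Suc n. B k)
    \<and> (AE w in M. (\<Sum>k<Suc n. f (x (Suc k) w) + \<psi> (x (Suc k) w) - (f z + \<psi> z)) \<le> W w)"
proof -
  have \<alpha>_nonneg: "0 \<le> \<alpha> k" for k using \<alpha> by (induction k) (auto intro: order_trans)
  have "\<forall>k. \<exists>W. integrable M W \<and> (LINT w|M. W w) \<le> B k \<and>
    (AE w in M. - (error k w \<bullet> (x (Suc k) w - z)) - \<alpha> k * bregman \<omega> g\<omega> (x k w) (x (Suc k) w) \<le> W w)"
    using error_cost[OF z \<alpha>_nonneg \<alpha>(3) B] by blast
  from choice[OF this] obtain W where "\<forall>k. integrable M (W k) \<and> (LINT w|M. W k w) \<le> B k \<and>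
    (AE w in M. - (error k w \<bullet> (x (Suc k) w - z)) - \<alpha> k * bregman \<omega> g\<omega> (x k w) (x (Suc k) w) \<le> W k w)"
    by (rule exE)
  then have W: "\<And>k. integrable M (W k)" "\<And>k. (LINT w|M. W k w) \<le> B k"
    "\<And>k. AE w in M. - (error k w \<bullet> (x (Suc k) w - z)) - \<alpha> k * bregman \<omega> g\<omega> (x k w) (x (Suc k) w) \<le> W k w"
    by (simp_all del: minus_le_iff)
  let ?c = "(L * (real \<tau> + 1)\<^sup>2 + \<alpha> n) * D"
  have "AE w in M. \<forall>k. - (error k w \<bullet> (x (Suc k) w - z)) - \<alpha> k * bregman \<omega> g\<omega> (x k w) (x (Suc k) w) \<le> W k w"
    using W(3) unfolding AE_all_countable by blast
  moreover have "AE w in M. \<forall>k. is_arg_min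
      (\<lambda>z. ((1 / real b) *\<^sub>R (\<Sum>i=1..b. G (x (d k) w) (X (k, i) w))) \<bullet> z + \<psi> z
        + 1 / \<gamma> k * bregman \<omega> g\<omega> (x k w) z) (\<lambda>z. z \<in> K) (x (Suc k) w)"
    using x_step unfolding AE_all_countable by blast
  ultimately have "AE w in M. (\<Sum>k<Suc n. f (x (Suc k) w) + \<psi> (x (Suc k) w) - (f z + \<psi> z))
      \<le> ?c + (\<Sum>k<Suc n. W k w)"
    using iterate_in_K
  proof eventually_elim
    case (elim w)
    show ?case
      by (rule asynchronous_regret[OF f lip \<psi>_convex z L d_le delay \<gamma>_pos \<gamma>_eq \<alpha>(1,2) D])
        (use elim in \<open>auto simp: error_eq\<close>)
  qed
  moreover have "(LINT w|M. ?c + (\<Sum>k<Suc n. W k w)) = ?c + (\<Sum>k<Suc n. LINT w|M. W k w)"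
    using W(1) by (simp add: Bochner_Integration.integral_sum prob_space del: sum.lessThan_Suc)
  moreover have "\<dots> \<le> ?c + (\<Sum>k<Suc n. B k)"
    using W(2) by (intro add_left_mono sum_mono) auto
  moreover have "integrable M (\<lambda>w. ?c + (\<Sum>k<Suc n. W k w))"
    using W(1) by (intro Bochner_Integration.integrable_add Bochner_Integration.integrable_sum) auto
  ultimately show ?thesis by (intro exI[of _ "\<lambda>w. ?c + (\<Sum>k<Suc n. W k w)"]) auto
qed

end

section \<open>Measurability, extended-real expectations and effective domains\<close>

text \<open>Replace \<open>y\<close> by simple functions that converge to it. For these the function is measurable, as it
  is a countable case distinction, and continuity in \<open>y\<close> allows the passage to the limit.\<close>
lemma borel_measurable_Caratheodory:
  fixes G :: "'a::euclidean_space \<Rightarrow> 's \<Rightarrow> 'b::euclidean_space"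
  assumes cont: "\<And>s. s \<in> space P \<Longrightarrow> continuous_on UNIV (\<lambda>y. G y s)"
    and meas: "\<And>y. G y \<in> borel_measurable P"
  shows "(\<lambda>(y, s). G y s) \<in> borel_measurable (borel \<Otimes>\<^sub>M P)"
proof -
  obtain F :: "nat \<Rightarrow> 'a \<Rightarrow> 'a" where F: "\<And>i. simple_function borel (F i)"
      "\<And>y. (\<lambda>i. F i y) \<longlonglongrightarrow> y"
    using borel_measurable_implies_sequence_metric[of "\<lambda>y. y" borel 0] by auto
  show ?thesis
  proof (rule borel_measurable_LIMSEQ_metric)
    fix i
    have fin: "finite (range (F i))" using simple_functionD(1)[OF F(1)[of i]] by simp
    then have "F i \<in> measurable borel (count_space (range (F i)))"
      using F(1)[of i] by (auto simp: measurable_count_space_eq2 simple_function_def)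
    note Fi = measurable_compose[OF measurable_fst this]
    have "(\<lambda>p. G (F i (fst p)) (snd p)) \<in> borel_measurable (borel \<Otimes>\<^sub>M P)"
      by (rule measurable_compose_countable'[where f="\<lambda>y p. G y (snd p)", OF _ Fi countable_finite[OF fin]])
        (rule measurable_compose[OF measurable_snd meas])
    then show "(\<lambda>(y, s). G (F i y) s) \<in> borel_measurable (borel \<Otimes>\<^sub>M P)"
      by (simp add: case_prod_beta')
  next
    fix p :: "'a \<times> 's"
    assume "p \<in> space (borel \<Otimes>\<^sub>M P)"
    then have "snd p \<in> space P" by (auto simp: space_pair_measure)
    from continuous_on_tendsto_compose[OF cont[OF this] F(2)]
    show "(\<lambda>i. case p of (y, s) \<Rightarrow> G (F i y) s) \<longlonglongrightarrow> (case p of (y, s) \<Rightarrow> G y s)"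
      by (simp add: case_prod_beta')
  qed
qed

text \<open>\<open>ereal_expectation\<close> is monotone even for non-measurable functions, and the bound is
  integrable, so the difference of the two parts is not of the form infinity minus infinity.\<close>
lemma ereal_expectation_le_integral:
  assumes le: "AE w in M. Y w \<le> ereal (W w)" and int: "integrable M W"
  shows "ereal_expectation M Y \<le> ereal (LINT w|M. W w)"
proof -
  have pos: "(\<integral>\<^sup>+w. e2ennreal (Y w) \<partial>M) \<le> (\<integral>\<^sup>+w. ennreal (W w) \<partial>M)"
    using le by (intro nn_integral_mono_AE) (auto elim!: eventually_mono simp: e2ennreal_mono simp flip: e2ennreal_ereal)
  have neg: "(\<integral>\<^sup>+w. ennreal (- W w) \<partial>M) \<le> (\<integral>\<^sup>+w. e2ennreal (- Y w) \<partial>M)"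
    using le by (intro nn_integral_mono_AE)
      (auto elim!: eventually_mono simp: e2ennreal_mono ereal_minus_le_minus simp flip: e2ennreal_ereal uminus_ereal.simps)
  have fin: "(\<integral>\<^sup>+w. ennreal (W w) \<partial>M) \<noteq> \<infinity>" "(\<integral>\<^sup>+w. ennreal (- W w) \<partial>M) \<noteq> \<infinity>"
    using int by (auto simp: real_integrable_def)
  then obtain p n where pn: "0 \<le> p" "(\<integral>\<^sup>+w. ennreal (W w) \<partial>M) = ennreal p"
      "0 \<le> n" "(\<integral>\<^sup>+w. ennreal (- W w) \<partial>M) = ennreal n"
    by (metis ennreal_cases infinity_ennreal_def)
  have "ereal_expectation M Y \<le> enn2ereal (ennreal p) - enn2ereal (ennreal n)"
    unfolding ereal_expectation_def using pos neg unfolding pn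
    by (intro ereal_minus_mono) (simp_all add: less_eq_ennreal.rep_eq)
  also have "\<dots> = ereal (LINT w|M. W w)"
    using pn by (simp add: real_lebesgue_integral_def[OF int] enn2ereal_ennreal)
  finally show ?thesis .
qed

lemma proper_eq_real:
  assumes "proper \<Psi>" "y \<in> effective_domain \<Psi>"
  shows "\<Psi> y = ereal (real_of_ereal (\<Psi> y))"
  using assms by (cases "\<Psi> y") (auto simp: proper_def effective_domain_def)

lemma convex_on_effective_domain:
  assumes proper: "proper \<Psi>" and convex: "ereal_convex \<Psi>"
  shows "convex_on (effective_domain \<Psi>) (\<lambda>y. real_of_ereal (\<Psi> y))"
proof -
  let ?K = "effective_domain \<Psi>" and ?\<psi> = "\<lambda>y. real_of_ereal (\<Psi> y)"
  have le: "\<Psi> ((1 - t) *\<^sub>R y + t *\<^sub>R z) \<le> ereal ((1 - t) * ?\<psi> y + t * ?\<psi> z)"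
    if "y \<in> ?K" "z \<in> ?K" "t \<in> {0..1}" for y z t
  proof -
    have "\<Psi> ((1 - t) *\<^sub>R y + t *\<^sub>R z) \<le> ereal (1 - t) * \<Psi> y + ereal t * \<Psi> z"
      using convex that(3) unfolding ereal_convex_def by blast
    also have "\<dots> = ereal ((1 - t) * ?\<psi> y + t * ?\<psi> z)"
      using proper_eq_real[OF proper that(1)] proper_eq_real[OF proper that(2)]
      by (metis plus_ereal.simps(1) times_ereal.simps(1))
    finally show ?thesis .
  qed
  have in_K: "(1 - t) *\<^sub>R y + t *\<^sub>R z \<in> ?K" if "y \<in> ?K" "z \<in> ?K" "t \<in> {0..1}" for y z t
    using le[OF that] unfolding effective_domain_def by (auto intro: le_less_trans)
  show ?thesis
  proof (rule convex_onI)
    show "convex ?K"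
      using in_K unfolding convex_alt by auto
    fix t :: real and y z
    assume t: "0 < t" "t < 1" and yz: "y \<in> ?K" "z \<in> ?K"
    then have t': "t \<in> {0..1}" by simp
    show "?\<psi> ((1 - t) *\<^sub>R y + t *\<^sub>R z) \<le> (1 - t) * ?\<psi> y + t * ?\<psi> z"
      using le[OF yz t'] proper_eq_real[OF proper in_K[OF yz t']] by (metis ereal_less_eq(3))
  qed
qed

text \<open>A minimizer has finite value because a proper function is finite somewhere.\<close>
lemma is_arg_min_effective_domain:
  fixes a c :: "_ \<Rightarrow> real"
  assumes proper: "proper \<Psi>" and y: "is_arg_min (\<lambda>z. ereal (a z) + \<Psi> z + ereal (c z)) (\<lambda>_. True) y"
  shows "is_arg_min (\<lambda>z. a z + real_of_ereal (\<Psi> z) + c z) (\<lambda>z. z \<in> effective_domain \<Psi>) y"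
proof -
  have min: "ereal (a y) + \<Psi> y + ereal (c y) \<le> ereal (a z) + \<Psi> z + ereal (c z)" for z
    using y by (simp add: is_arg_min_linorder)
  have eq: "ereal (a z) + \<Psi> z + ereal (c z) = ereal (a z + real_of_ereal (\<Psi> z) + c z)"
    if "z \<in> effective_domain \<Psi>" for z
    using proper_eq_real[OF proper that] by (metis plus_ereal.simps(1))
  obtain z0 where z0: "z0 \<in> effective_domain \<Psi>" using proper by (auto simp: proper_def)
  have y_dom: "y \<in> effective_domain \<Psi>"
    using min[of z0] unfolding eq[OF z0] by (auto simp: effective_domain_def)
  have "a y + real_of_ereal (\<Psi> y) + c y \<le> a z + real_of_ereal (\<Psi> z) + c z"
    if "z \<in> effective_domain \<Psi>" for z
    using min[of z] unfolding eq[OF that] eq[OF y_dom] by simp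
  with y_dom show ?thesis by (simp add: is_arg_min_linorder)
qed

section \<open>The convergence rate\<close>

theorem theorem2:
  fixes N :: "real^'n \<Rightarrow> real"
    and P :: "(real^'m) measure" and \<Xi> :: "(real^'m) set"
    and F :: "real^'n \<Rightarrow> real^'m \<Rightarrow> real" and gradF :: "real^'n \<Rightarrow> real^'m \<Rightarrow> real^'n"
    and f :: "real^'n \<Rightarrow> real" and gradf :: "real^'n \<Rightarrow> real^'n"
    and \<Psi> \<phi> :: "real^'n \<Rightarrow> ereal" and phi_star :: ereal
    and X :: "(real^'n) set" and \<omega> :: "real^'n \<Rightarrow> real" and g\<omega> :: "real^'n \<Rightarrow> real^'n"
    and L \<sigma> R c :: real and b \<tau>max :: nat
    and \<gamma> \<alpha> :: "nat \<Rightarrow> real" and d :: "nat \<Rightarrow> nat"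
    and M :: "'w measure" and \<xi> :: "nat \<Rightarrow> nat \<Rightarrow> 'w \<Rightarrow> real^'m"
    and x0 :: "real^'n" and x g_ave :: "nat \<Rightarrow> 'w \<Rightarrow> real^'n"
  assumes norm: "is_norm N"
    and P_prob: "prob_space P" and P_sets: "sets P = sets borel"
    and P_supp: "AE s in P. s \<in> \<Xi>"
    and F_convex: "\<And>s. s \<in> \<Xi> \<Longrightarrow> convex_on UNIV (\<lambda>y. F y s)"
    and F_grad: "\<And>y s. s \<in> \<Xi> \<Longrightarrow> GDERIV (\<lambda>y. F y s) y :> gradF y s"
    and F_int: "\<And>y. integrable P (F y)" and gradF_int: "\<And>y. integrable P (gradF y)"
    and f_eq: "\<And>y. f y = (LINT s|P. F y s)"
    and f_convex: "convex_on UNIV f"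
    and f_grad: "\<And>y. GDERIV f y :> gradf y"
    and gradf_eq: "\<And>y. gradf y = (LINT s|P. gradF y s)"
    and \<Psi>_proper: "proper \<Psi>" and \<Psi>_convex: "ereal_convex \<Psi>"
    and \<phi>_eq: "\<And>y. \<phi> y = ereal (f y) + \<Psi> y"
    and phi_star_eq: "phi_star = (INF y. \<phi> y)"
    and minimizers: "{y. is_arg_min \<phi> (\<lambda>_. True) y} \<noteq> {}"
    and Lipschitz: "\<And>s y z. s \<in> \<Xi> \<Longrightarrow> dual_norm N (gradF y s - gradF z s) \<le> L * N (y - z)"
    and \<sigma>_nonneg: "0 \<le> \<sigma>"
    and variance: "\<And>y. (\<integral>\<^sup>+s. ennreal ((dual_norm N (gradF y s - gradf y))\<^sup>2) \<partial>P) \<le> ennreal (\<sigma>\<^sup>2)"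
    and \<Psi>_lsc: "lower_semicontinuous \<Psi>"
    and dom_closed: "closed (effective_domain \<Psi>)"
    and dom_X: "effective_domain \<Psi> \<subseteq> X"
    and dgf: "distance_generating N X \<omega> g\<omega>"
    and dom_compact: "compact (effective_domain \<Psi>)"
    and D_bounded: "bounded {bregman \<omega> g\<omega> y z |y z. y \<in> effective_domain \<Psi> \<and> z \<in> effective_domain \<Psi>}"
    and R_nonneg: "0 \<le> R"
    and R_eq: "is_max {bregman \<omega> g\<omega> y z |y z. y \<in> effective_domain \<Psi> \<and> z \<in> effective_domain \<Psi>} (R\<^sup>2)"
    and b_pos: "1 \<le> b"
    and delay: "\<And>k. d k \<le> k" "\<And>k. k - d k \<le> \<tau>max"
    and c_range: "c \<in> {1..real b}"
    and c_eq: "if dual_norm N = norm then c = 1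
               else \<exists>m. is_max (\<omega> ` {y \<in> X. N y \<le> 1}) m \<and> c = 2 * m"
    and \<alpha>_eq: "\<And>k. \<alpha> k = \<sigma> * sqrt c * sqrt (real (k + 1)) / (R * sqrt (real b))"
    and \<gamma>_pos: "\<And>k. 0 < \<gamma> k"
    and \<gamma>_eq: "\<And>k. inverse (\<gamma> k) = L * (real \<tau>max + 1)\<^sup>2 + \<alpha> k"
    and M_prob: "prob_space M"
    and \<xi>_indep: "prob_space.indep_vars M (\<lambda>_. borel) (\<lambda>(k, i). \<xi> k i) (UNIV \<times> {1..b})"
    and \<xi>_distr: "\<And>k i. i \<in> {1..b} \<Longrightarrow> distr M borel (\<xi> k i) = P"
    and x_rv: "\<And>k. x k \<in> borel_measurable M"
    and x0_dom: "x0 \<in> effective_domain \<Psi>"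
    and x_init: "AE w in M. x 0 w = x0"
    and g_ave_eq: "\<And>k w. g_ave k w = (1 / real b) *\<^sub>R (\<Sum>i=1..b. gradF (x (d k) w) (\<xi> k i w))"
    and x_step: "\<And>k. AE w in M.
          is_arg_min (\<lambda>z. ereal (inner (g_ave k w) z) + \<Psi> z
                          + ereal (1 / \<gamma> k * bregman \<omega> g\<omega> (x k w) z))
                     (\<lambda>_. True) (x (Suc k) w)"
  shows "\<forall>T::nat. 1 \<le> T \<longrightarrow>
     ereal_expectation M (\<lambda>w. \<phi> ((1 / real T) *\<^sub>R (\<Sum>k=1..T. x k w))) - phi_star
       \<le> ereal (L * R\<^sup>2 * (real \<tau>max + 1)\<^sup>2 / real T
                + 2 * \<sigma> * R * sqrt c / sqrt (real b * real T))"
proof -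
  define K where "K = effective_domain \<Psi>"
  define \<psi> where "\<psi> y = real_of_ereal (\<Psi> y)" for y
  define X' where "X' = (\<lambda>(k, i). \<xi> k i)"
  interpret P: prob_space P by (rule P_prob)
  interpret M: prob_space M by (rule M_prob)
  have \<psi>: "convex_on K \<psi>"
    unfolding K_def \<psi>_def by (rule convex_on_effective_domain[OF \<Psi>_proper \<Psi>_convex])
  have \<Psi>_eq: "\<Psi> y = ereal (\<psi> y)" if "y \<in> K" for y
    unfolding \<psi>_def using proper_eq_real[OF \<Psi>_proper] that by (simp add: K_def)
  have deriv: "(\<omega> has_derivative (\<lambda>h. g\<omega> y \<bullet> h)) (at y within K)" if "y \<in> K" for y
    using dgf that dom_X unfolding distance_generating_def K_def
    by (blast intro: has_derivative_subset)
  have half: "(N (z - y))\<^sup>2 / 2 \<le> bregman \<omega> g\<omega> y z" if "y \<in> K" "z \<in> K" for y z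
  proof -
    have "\<omega> z \<ge> \<omega> y + inner (g\<omega> y) (z - y) + 1 / 2 * (N (z - y))\<^sup>2"
      using dgf that dom_X unfolding distance_generating_def K_def by blast
    then show ?thesis by (simp add: bregman_def)
  qed
  interpret mirror: compact_mirror_map N K \<omega> g\<omega>
  proof
    show "continuous_on K g\<omega>"
      using dgf dom_X unfolding distance_generating_def K_def by (blast intro: continuous_on_subset)
    show "convex K" by (rule convex_on_imp_convex[OF \<psi>])
    show "K \<noteq> {}" using x0_dom by (auto simp: K_def)
  qed (use norm dom_compact deriv half in \<open>auto simp: K_def\<close>)

  obtain \<Xi>0 where \<Xi>0: "{s \<in> space P. s \<notin> \<Xi>} \<subseteq> \<Xi>0" "emeasure P \<Xi>0 = 0" "\<Xi>0 \<in> sets P"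
    using P_supp by (rule AE_E)
  \<comment> \<open>a measurable set of full measure inside \<open>\<Xi>\<close>, which need not be measurable itself;
    outside \<open>\<Xi>\<close> the gradients are arbitrary\<close>
  define S where "S = space P - \<Xi>0"
  have S: "S \<in> sets P" "S \<subseteq> \<Xi>" using \<Xi>0 by (auto simp: S_def)
  have S_AE: "AE s in P. s \<in> S"
    unfolding S_def using AE_not_in[of \<Xi>0 P] AE_space[of P] \<Xi>0 by (auto simp: null_sets_def)
  then obtain s0 where s0: "s0 \<in> S"
    using P.AE_False by (metis (mono_tags, lifting) eventually_mono)
  \<comment> \<open>the gradient oracle, cut off so that it is continuous in \<open>y\<close> for every \<open>s\<close>\<close>
  define G where "G y s = indicator S s *\<^sub>R gradF y s" for y s
  have G_eq: "G y s = gradF y s" if "s \<in> S" for y s using that by (simp add: G_def)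
  have G_AE: "AE s in P. G y s = gradF y s" for y
    using S_AE by eventually_elim (simp add: G_eq)
  have gradF_meas: "gradF y \<in> borel_measurable P" for y using gradF_int[of y] by simp
  have G_meas1: "G y \<in> borel_measurable P" for y
    unfolding G_def using gradF_meas S by measurable
  have G_int: "integrable P (G y)" for y
    by (rule integrable_cong_AE_imp[OF gradF_int[of y] G_meas1]) (use G_AE[of y] in auto)
  have G_mean: "(LINT s|P. G y s) = gradf y" for y
    unfolding gradf_eq by (intro integral_cong_AE G_meas1 gradF_meas G_AE)

  have L: "0 \<le> L"
  proof -
    obtain e :: "real^'n" where e: "e \<noteq> 0" using zero_neq_one by metis
    have "0 \<le> dual_norm N (gradF e s0 - gradF 0 s0)" by (rule dual_norm_nonneg[OF norm])
    also have "\<dots> \<le> L * N e" using Lipschitz[of s0 e 0] s0 S by auto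
    finally have "0 \<le> L * N e" .
    moreover have "0 < N e" using e norm unfolding is_norm_def by (simp add: less_le)
    ultimately show ?thesis by (simp add: zero_le_mult_iff)
  qed
  have G_lip: "h \<bullet> (G z s - G y s) \<le> L * N h * N (z - y)" for h y z s
  proof (cases "s \<in> S")
    case True
    have "h \<bullet> (G z s - G y s) \<le> N h * dual_norm N (gradF z s - gradF y s)"
      using inner_le_dual_norm[OF norm] True by (simp add: G_eq)
    also have "\<dots> \<le> N h * (L * N (z - y))"
      using Lipschitz[of s z y] True S norm by (intro mult_left_mono) (auto simp: is_norm_def)
    finally show ?thesis by (simp add: mult_ac)
  next
    case False
    then show ?thesis using L norm by (simp add: G_def is_norm_def)
  qed
  have lip: "h \<bullet> ((LINT s|P. G z s) - (LINT s|P. G y s)) \<le> L * N h * N (z - y)" for h y z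
  proof -
    have "h \<bullet> ((LINT s|P. G z s) - (LINT s|P. G y s)) = (LINT s|P. h \<bullet> (G z s - G y s))"
      using G_int by simp
    also have "\<dots> \<le> (LINT s|P. L * N h * N (z - y))"
      using G_int by (intro integral_mono G_lip) auto
    finally show ?thesis by (simp add: P.prob_space)
  qed
  have G_cont: "continuous_on UNIV (\<lambda>y. G y s)" for s
  proof (cases "s \<in> S")
    case True
    obtain C where C: "0 < C" "\<And>y. norm y \<le> C * dual_norm N y" using norm_le_dual_norm[OF norm] by blast
    obtain C' where C': "0 < C'" "\<And>x. N x \<le> C' * norm x" using is_norm_le_norm[OF norm] by blast
    have "dist (G y s) (G z s) \<le> C * (L * C') * dist y z" for y z
    proof -
      have "norm (G y s - G z s) \<le> C * dual_norm N (gradF y s - gradF z s)"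
        using C(2) True by (simp add: G_eq)
      also have "\<dots> \<le> C * (L * N (y - z))"
        using Lipschitz[of s y z] True S C(1) by (intro mult_left_mono) auto
      also have "\<dots> \<le> C * (L * (C' * norm (y - z)))"
        using C(1) L C'(2) by (intro mult_left_mono) auto
      finally show ?thesis by (simp add: dist_norm mult_ac)
    qed
    then have "(C * (L * C'))-lipschitz_on UNIV (\<lambda>y. G y s)"
      using C C' L by (intro lipschitz_onI) auto
    then show ?thesis by (rule lipschitz_on_continuous_on)
  next
    case False
    then show ?thesis by (simp add: G_def)
  qed
  have G_var: "(\<integral>\<^sup>+s. ennreal ((dual_norm N (G y s - (LINT s|P. G y s)))\<^sup>2) \<partial>P) \<le> ennreal (\<sigma>\<^sup>2)" for y
  proof -
    have "(\<integral>\<^sup>+s. ennreal ((dual_norm N (G y s - (LINT s|P. G y s)))\<^sup>2) \<partial>P)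
        = (\<integral>\<^sup>+s. ennreal ((dual_norm N (gradF y s - gradf y))\<^sup>2) \<partial>P)"
      unfolding G_mean using G_AE[of y] by (intro nn_integral_cong_AE) auto
    with variance show ?thesis by simp
  qed

  have X'_meas: "X' j \<in> measurable M P" if "j \<in> UNIV \<times> {1..b}" for j
    using \<xi>_indep that unfolding M.indep_vars_def X'_def[symmetric] measurable_cong_sets[OF refl P_sets]
    by blast
  have X'_distr: "distr M P (X' j) = P" if j: "j \<in> UNIV \<times> {1..b}" for j
  proof -
    obtain k i where ki: "j = (k, i)" "i \<in> {1..b}" using j by auto
    have "distr M P (\<xi> k i) = distr M borel (\<xi> k i)" by (rule distr_cong) (auto simp: P_sets)
    with \<xi>_distr[OF ki(2)] ki show ?thesis by (simp add: X'_def)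
  qed
  interpret iid_samples M P X' "UNIV \<times> {1..b}"
  proof
    show "M.indep_vars (\<lambda>_. P) X' (UNIV \<times> {1..b})"
      using \<xi>_indep X'_meas P_sets unfolding M.indep_vars_def X'_def[symmetric] by simp
  qed (rule X'_distr)
  interpret stochastic_gradient M P X' "UNIV \<times> {1..b}" N G \<sigma>
    by unfold_locales (intro norm borel_measurable_Caratheodory G_cont G_meas1 G_int G_var)+
  have "AE w in M. X' j w \<in> S" if j: "j \<in> UNIV \<times> {1..b}" for j
    using S_AE by (intro AE_distrD[OF X'_meas[OF j]]) (subst X'_distr[OF j])
  then have "AE w in M. \<forall>j\<in>UNIV \<times> {1..b}. X' j w \<in> S"
    by (subst AE_ball_countable) auto
  then have samples: "AE w in M. \<forall>k. \<forall>i\<in>{1..b}. \<xi> k i w \<in> S"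
    by eventually_elim (auto simp: X'_def)
  interpret asynchronous_mirror_descent N K \<omega> g\<omega> M P X' b G \<sigma> \<psi> \<gamma> d x0 x
  proof
    fix k
    show "AE w in M. is_arg_min
      (\<lambda>z. ((1 / real b) *\<^sub>R (\<Sum>i=1..b. G (x (d k) w) (X' (k, i) w))) \<bullet> z + \<psi> z
        + 1 / \<gamma> k * bregman \<omega> g\<omega> (x k w) z) (\<lambda>z. z \<in> K) (x (Suc k) w)"
      using x_step[of k] samples
    proof eventually_elim
      case (elim w)
      have "(\<Sum>i=1..b. G (x (d k) w) (X' (k, i) w)) = (\<Sum>i=1..b. gradF (x (d k) w) (\<xi> k i w))"
        using elim(2) by (intro sum.cong refl) (simp add: X'_def G_eq)
      with is_arg_min_effective_domain[OF \<Psi>_proper elim(1)] show ?case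
        by (simp add: K_def \<psi>_def g_ave_eq)
    qed
  qed (use b_pos \<psi> \<gamma>_pos delay x0_dom x_init in \<open>auto simp: K_def\<close>)

  obtain z where z: "\<And>y. \<phi> z \<le> \<phi> y"
    using minimizers by (auto simp: is_arg_min_linorder)
  have phi_star: "phi_star = \<phi> z"
    unfolding phi_star_eq using z by (intro antisym INF_lower INF_greatest) auto
  have zK: "z \<in> K"
  proof -
    have "\<phi> z \<le> ereal (f x0 + \<psi> x0)" using z[of x0] \<Psi>_eq[of x0] x0_dom by (simp add: \<phi>_eq K_def)
    then show ?thesis by (auto simp: \<phi>_eq K_def effective_domain_def)
  qed
  have \<phi>_real: "\<phi> y = ereal (f y + \<psi> y)" if "y \<in> K" for y
    using \<Psi>_eq[OF that] by (simp add: \<phi>_eq)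
  have D: "bregman \<omega> g\<omega> y z \<le> R\<^sup>2" if "y \<in> K" for y
    using R_eq that zK unfolding is_max_def K_def by blast
  \<comment> \<open>for \<open>R = 0\<close> the quotient \<open>\<alpha> k\<close> is 0 by convention, so this case needs its own reason\<close>
  have singleton: "K = {z}" if "R = 0"
  proof -
    have "y = z" if "y \<in> K" for y
    proof -
      have "bregman \<omega> g\<omega> y z \<le> 0" using D[OF that] \<open>R = 0\<close> by simp
      with half[OF that zK] have "(N (z - y))\<^sup>2 \<le> 0" by linarith
      then have "N (z - y) = 0" by simp
      with norm show "y = z" by (simp add: is_norm_def)
    qed
    with zK show ?thesis by blast
  qed
  have c: "1 \<le> c" using c_range by simp
  have b: "0 < real b" using b_pos by simp
  have \<alpha>_zero: "\<sigma> = 0 \<or> R = 0" if "\<alpha> k = 0" for k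
    using that c b unfolding \<alpha>_eq by auto
  \<comment> \<open>the cost \<open>\<sigma>\<^sup>2 / (2 * \<alpha> k * real b)\<close> of the batch error, with \<open>1 / sqrt c\<close>
    enlarged to \<open>sqrt c\<close> to match the other half of the bound\<close>
  define B where "B k = \<sigma> * R * sqrt c / (2 * sqrt (real b)) * (1 / sqrt (real (k + 1)))" for k
  have B_nonneg: "0 \<le> B k" for k
    using \<sigma>_nonneg R_nonneg c by (simp add: B_def)
  have B_ge: "\<sigma>\<^sup>2 / (2 * \<alpha> k * real b) \<le> B k" if "\<alpha> k \<noteq> 0" for k
  proof -
    have "R \<noteq> 0" "\<sigma> \<noteq> 0" using that unfolding \<alpha>_eq by auto
    then have R: "0 < R" and \<sigma>: "0 < \<sigma>" using R_nonneg \<sigma>_nonneg by linarith+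
    have "\<sigma> * \<sigma> / (2 * (\<sigma> * p * q / (R * r)) * (r * r)) = \<sigma> * R * (1 / p) / (2 * r) * (1 / q)"
      if "0 < p" "0 < q" "0 < r" for p q r
      using that R \<sigma> by (simp add: field_simps)
    from this[of "sqrt c" "sqrt (real (k + 1))" "sqrt (real b)"]
    have "\<sigma>\<^sup>2 / (2 * \<alpha> k * real b) = \<sigma> * R * (1 / sqrt c) / (2 * sqrt (real b)) * (1 / sqrt (real (k + 1)))"
      using c b by (simp add: \<alpha>_eq power2_eq_square)
    also have "\<dots> \<le> B k"
    proof -
      have "1 / sqrt c \<le> 1" using c by (simp add: field_simps)
      also have "1 \<le> sqrt c" using c by simp
      finally show ?thesis unfolding B_def using R \<sigma>
        by (intro mult_right_mono divide_right_mono mult_left_mono) auto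
    qed
    finally show ?thesis .
  qed
  have f_grad': "GDERIV f y :> (LINT s|P. G y s)" for y using f_grad[of y] by (simp add: G_mean)
  have \<alpha>0: "0 \<le> \<alpha> 0" using \<sigma>_nonneg R_nonneg c unfolding \<alpha>_eq by simp
  have \<alpha>_mono: "\<alpha> k \<le> \<alpha> (Suc k)" for k
    unfolding \<alpha>_eq using \<sigma>_nonneg R_nonneg c by (intro divide_right_mono mult_left_mono) auto

  show ?thesis
  proof (intro allI impI)
    fix T :: nat
    assume "1 \<le> T"
    then obtain n where n: "T = Suc n" by (cases T) auto
    obtain W where W: "integrable M W"
        "(LINT w|M. W w) \<le> (L * (real \<tau>max + 1)\<^sup>2 + \<alpha> n) * R\<^sup>2 + (\<Sum>k<T. B k)"
        "AE w in M. (\<Sum>k<T. f (x (Suc k) w) + \<psi> (x (Suc k) w) - (f z + \<psi> z)) \<le> W w"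
      using expected_regret[OF f_convex f_grad' lip L delay(2) \<gamma>_eq \<alpha>0 \<alpha>_mono _ B_nonneg B_ge zK D, of n]
        \<alpha>_zero singleton unfolding n by blast
    have "AE w in M. \<phi> ((1 / real T) *\<^sub>R (\<Sum>k=1..T. x k w)) \<le> ereal (f z + \<psi> z + W w / real T)"
      using W(3) iterate_in_K
    proof eventually_elim
      case (elim w)
      let ?avg = "\<Sum>k<T. (1 / real T) *\<^sub>R x (Suc k) w"
      have avg: "(1 / real T) *\<^sub>R (\<Sum>k=1..T. x k w) = ?avg"
        by (simp add: scaleR_sum_right sum.atLeast1_atMost_eq)
      have "?avg \<in> K"
        using elim(2) n by (intro convex_sum mirror.convex_K) auto
      have "convex_on K (\<lambda>y. f y + \<psi> y)"
        using f_convex \<psi> mirror.convex_K by (intro convex_on_add) (auto intro: convex_on_subset)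
      then have "f ?avg + \<psi> ?avg \<le> (\<Sum>k<T. (1 / real T) * (f (x (Suc k) w) + \<psi> (x (Suc k) w)))"
        using elim(2) n by (intro convex_on_sum) auto
      also have "\<dots> = f z + \<psi> z + (\<Sum>k<T. f (x (Suc k) w) + \<psi> (x (Suc k) w) - (f z + \<psi> z)) / real T"
        using n by (simp add: sum_subtractf sum_divide_distrib[symmetric] diff_divide_distrib del: sum.lessThan_Suc)
      also have "\<dots> \<le> f z + \<psi> z + W w / real T"
        using elim(1) by (intro add_left_mono divide_right_mono) auto
      finally show ?case unfolding avg \<phi>_real[OF \<open>?avg \<in> K\<close>] by simp
    qed
    then have "ereal_expectation M (\<lambda>w. \<phi> ((1 / real T) *\<^sub>R (\<Sum>k=1..T. x k w)))
        \<le> ereal (LINT w|M. f z + \<psi> z + W w / real T)"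
      using W(1) by (intro ereal_expectation_le_integral) auto
    also have "(LINT w|M. f z + \<psi> z + W w / real T) = f z + \<psi> z + (LINT w|M. W w) / real T"
      using W(1) by (simp add: M.prob_space)
    finally have "ereal_expectation M (\<lambda>w. \<phi> ((1 / real T) *\<^sub>R (\<Sum>k=1..T. x k w))) - phi_star
        \<le> ereal (f z + \<psi> z + (LINT w|M. W w) / real T) - ereal (f z + \<psi> z)"
      unfolding phi_star \<phi>_real[OF zK] by (intro ereal_minus_mono) auto
    also have "\<dots> = ereal ((LINT w|M. W w) / real T)" by simp
    also have "(LINT w|M. W w) / real T \<le> L * R\<^sup>2 * (real \<tau>max + 1)\<^sup>2 / real T
                + 2 * \<sigma> * R * sqrt c / sqrt (real b * real T)"
    proof -
      let ?E = "\<sigma> * R * sqrt c / sqrt (real b)"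
      have "B k = ?E / 2 * (1 / sqrt (real (k + 1)))" for k by (simp add: B_def)
      then have "(\<Sum>k<T. B k) = ?E / 2 * (\<Sum>k<T. 1 / sqrt (real (k + 1)))"
        by (simp only: sum_distrib_left)
      also have "\<dots> \<le> ?E / 2 * (2 * sqrt (real T))"
        using \<sigma>_nonneg R_nonneg c by (intro mult_left_mono sum_inverse_sqrt_le) auto
      finally have sumB: "(\<Sum>k<T. B k) \<le> ?E * sqrt (real T)" by simp
      have "\<alpha> n * R\<^sup>2 = ?E * sqrt (real T)"
        unfolding \<alpha>_eq n by (simp add: power2_eq_square)
      moreover have "(L * (real \<tau>max + 1)\<^sup>2 + \<alpha> n) * R\<^sup>2 = L * R\<^sup>2 * (real \<tau>max + 1)\<^sup>2 + \<alpha> n * R\<^sup>2"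
        by (simp add: algebra_simps)
      ultimately have "(LINT w|M. W w) \<le> L * R\<^sup>2 * (real \<tau>max + 1)\<^sup>2 + 2 * ?E * sqrt (real T)"
        using W(2) sumB by linarith
      then have "(LINT w|M. W w) / real T \<le> (L * R\<^sup>2 * (real \<tau>max + 1)\<^sup>2 + 2 * ?E * sqrt (real T)) / real T"
        by (intro divide_right_mono) auto
      also have "\<dots> = L * R\<^sup>2 * (real \<tau>max + 1)\<^sup>2 / real T + 2 * ?E * (sqrt (real T) / real T)"
        by (simp add: add_divide_distrib)
      also have "sqrt (real T) / real T = 1 / sqrt (real T)" using n by (simp add: real_div_sqrt field_simps)
      finally show ?thesis by (simp add: real_sqrt_mult mult_ac)
    qed
    finally show "ereal_expectation M (\<lambda>w. \<phi> ((1 / real T) *\<^sub>R (\<Sum>k=1..T. x k w))) - phi_star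
       \<le> ereal (L * R\<^sup>2 * (real \<tau>max + 1)\<^sup>2 / real T
                + 2 * \<sigma> * R * sqrt c / sqrt (real b * real T))"
      by simp
  qed
qed

end
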